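(* Let $\mathcal G$ be a finite connected compact metric graph with Kirchhoff conditions at interior vertices and a fixed Dirichlet or Neumann condition at each exterior vertex, and let the length vector $\ell\in(0,\infty)^{\mathcal E}$ be rationally independent. Then for every proper primitive subgraph $K\subsetneq\mathcal G$, $\operatorname{RAC}(K,\ell)$ holds, i.e. $H_\ell\cap\mathcal R_K\ne\varnothing$, and consequently there exist $k_n\to\infty$ and eigenfunctions $u_n$ with $\|u_n\|_{L^2(\mathcal G)}=1$ such that $$-\Delta_{\mathcal G,\ell}u_n=k_n^2u_n,\qquad\|u_n\|_{L^2(\mathcal G\setminus K)}\to0,\qquad|u_n|^2\,dx\rightharpoonup\frac1{L_K}\,dx\big|_K,$$ where $L_K=\sum_{e\subset K}\ell_e$.
   Context: Setting. $\mathcal G=(\mathcal V,\mathcal E,\ell)$: finite connected graph (loops and parallel edges allowed), each edge $e$ identified with $[0,\ell_e]$, $\ell_e>0$. A vertex is exterior if it has degree one (loops count twice), interior otherwise. $L^2(\mathcal G)=\bigoplus_{e}L^2(0,\ell_e)$. $-\Delta_{\mathcal G,\ell}$ is the self-adjoint operator acting as $-u''$ on each edge, on edgewise $H^2$ functions that at each interior vertex are continuous and have vanishing sum of normal derivatives (Kirchhoff), and at each exterior vertex $v$ satisfy the fixed prescribed condition, $u(v)=0$ (Dirichlet) or $\partial_\nu u(v)=0$ (Neumann). A loop is a one-edge simple cycle, and two parallel edges may form a two-edge simple cycle. A primitive subgraph is a simple cycle or a simple path joining two exterior vertices; it is proper if it is not all of $\mathcal G$. Secular objects. $\mathbb T=\mathbb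 R/2\pi\mathbb Z$. Let $\mathcal B$ be the set of directed bonds (each edge $e$ gives two, $(e,+)$ and $(e,-)$, reverses of each other). Let $S_B$ be the unitary matrix on $\mathbb C^{\mathcal B}$ with $(S_Ba)_b=\sum_{b'}\sigma_{bb'}a_{b'}$, the sum over bonds $b'$ ending at the initial vertex $v$ of $b$; if $v$ is interior of degree $d$, $\sigma_{bb'}=2/d-1$ if $b'$ is the reverse of $b$ and $2/d$ otherwise; if $v$ is exterior, $\sigma_{bb'}=-1$ (Dirichlet) or $+1$ (Neumann). For $\theta\in\mathbb T^{\mathcal E}$, $D(\theta)$ is the diagonal matrix with entry $e^{i\theta_e}$ on both bonds of $e$, $U_B(\theta)=D(\theta)S_B$, $I_e(a)=|a_{e,+}|^2+|a_{e,-}|^2$, $Z_B=\{\theta:\det(I-U_B(\theta))=0\}$. $\mathcal R_K\subset Z_B$ is the set of $\theta$ for which $1$ is a simple eigenvalue of $U_B(\theta)$ and its eigenvector $a$ is supported exactly on $K$ ($I_e(a)>0$ iff $e\subset K$). $H_\ell=\overline{\{[k\ell]:k\in\mathbb R\}}\subset\mathbb T^{\mathcal E}$. $\ell$ is rationally independent if $m\cdot\ell=0$, $m\in\mathbb Z^{\mathcal E}$, implies $m=0$. *)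

theory Defs
  imports "HOL-Analysis.Analysis"
begin

section \<open>The torus\<close>

definition angle_rel :: "real \<Rightarrow> real \<Rightarrow> bool" where
  "angle_rel x y \<longleftrightarrow> (\<exists>n::int. x - y = 2 * pi * of_int n)"

lemma equivp_angle_rel: "equivp angle_rel"
proof (rule equivpI)
  show "reflp angle_rel"
    by (rule reflpI, unfold angle_rel_def, rule exI[of _ 0], simp)
  show "symp angle_rel"
  proof (rule sympI)
    fix x y assume "angle_rel x y"
    then obtain n :: int where "x - y = 2 * pi * of_int n" unfolding angle_rel_def by blast
    then have "y - x = 2 * pi * of_int (- n)" by simp
    then show "angle_rel y x" unfolding angle_rel_def by blast
  qed
  show "transp angle_rel"
  proof (rule transpI)
    fix x y z assume "angle_rel x y" "angle_rel y z"
    then obtain m n :: int where "x - y = 2 * pi * of_int m" "y - z = 2 * pi * of_int n"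
      unfolding angle_rel_def by blast
    then have "x - z = 2 * pi * of_int (m + n)" by (simp add: algebra_simps)
    then show "angle_rel x z" unfolding angle_rel_def by blast
  qed
qed

quotient_type angle = real / angle_rel
  by (rule equivp_angle_rel)

text \<open>The quotient topology; \<open>angle ^ 'e\<close> then carries the product topology.\<close>

instantiation angle :: topological_space
begin

definition open_angle :: "angle set \<Rightarrow> bool" where
  "open_angle U \<longleftrightarrow> open (abs_angle -` U)"

instance
  by standard (auto simp: open_angle_def vimage_Union)

end

lift_definition cis_angle :: "angle \<Rightarrow> complex" is cis
proof -
  fix x y assume "angle_rel x y"
  then obtain n :: int where "x - y = 2 * pi * of_int n" unfolding angle_rel_def by blast
  then have "x = y + 2 * pi * of_int n" by simp
  then have "cis x = cis y * cis (2 * pi * of_int n)" by (simp only: cis_mult)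
  also have "cis (2 * pi * of_int n) = 1" by (rule cis_multiple_2pi) simp
  finally show "cis x = cis y" by simp
qed


section \<open>Graphs\<close>

datatype boundary_condition = Dirichlet | Neumann

text \<open>
  A multigraph with vertex type \<open>'v\<close> and edge type \<open>'e\<close>. Given a length vector \<open>len\<close>, the edge \<open>e\<close>
  is identified with \<open>{0..len $ e}\<close>, where \<open>0\<close> is its tail and \<open>len $ e\<close> its head. The field \<open>bc\<close> is only ever read at
  exterior vertices.
\<close>

record ('v, 'e) qgraph =
  tail :: "'e \<Rightarrow> 'v"
  head :: "'e \<Rightarrow> 'v"
  bc :: "'v \<Rightarrow> boundary_condition"

text \<open>The bond \<open>(e, True)\<close> runs from tail to head, \<open>(e, False)\<close> from head to tail.\<close>

type_synonym 'e bond = "'e \<times> bool"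

definition reverse_bond :: "'e bond \<Rightarrow> 'e bond" where
  "reverse_bond b = (fst b, \<not> snd b)"

definition origin :: "('v, 'e) qgraph \<Rightarrow> 'e bond \<Rightarrow> 'v" where
  "origin G b = (if snd b then tail G (fst b) else head G (fst b))"

definition terminus :: "('v, 'e) qgraph \<Rightarrow> 'e bond \<Rightarrow> 'v" where
  "terminus G b = (if snd b then head G (fst b) else tail G (fst b))"

definition connected_graph :: "('v, 'e) qgraph \<Rightarrow> bool" where
  "connected_graph G \<longleftrightarrow> {(origin G b, terminus G b) | b. True}\<^sup>* = UNIV"

definition vdegree :: "('v, 'e::finite) qgraph \<Rightarrow> 'v \<Rightarrow> nat" where
  "vdegree G v = card {e. tail G e = v} + card {e. head G e = v}"

definition exterior :: "('v, 'e::finite) qgraph \<Rightarrow> 'v \<Rightarrow> bool" where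
  "exterior G v \<longleftrightarrow> vdegree G v = 1"

text \<open>
  Subgraphs without isolated vertices are given by their edge sets. In a cycle, distinctness of
  the edges excludes running back and forth along a single edge.
\<close>

definition simple_cycle :: "('v, 'e) qgraph \<Rightarrow> 'e set \<Rightarrow> bool" where
  "simple_cycle G K \<longleftrightarrow>
     (\<exists>bs. bs \<noteq> [] \<and> successively (\<lambda>b b'. terminus G b = origin G b') bs \<and>
        terminus G (last bs) = origin G (hd bs) \<and>
        distinct (map (origin G) bs) \<and> distinct (map fst bs) \<and> K = fst ` set bs)"

definition simple_exterior_path :: "('v, 'e::finite) qgraph \<Rightarrow> 'e set \<Rightarrow> bool" where
  "simple_exterior_path G K \<longleftrightarrow>
     (\<exists>bs. bs \<noteq> [] \<and> successively (\<lambda>b b'. terminus G b = origin G b') bs \<and>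
        distinct (origin G (hd bs) # map (terminus G) bs) \<and>
        exterior G (origin G (hd bs)) \<and> exterior G (terminus G (last bs)) \<and>
        K = fst ` set bs)"

definition primitive_subgraph :: "('v, 'e::finite) qgraph \<Rightarrow> 'e set \<Rightarrow> bool" where
  "primitive_subgraph G K \<longleftrightarrow> simple_cycle G K \<or> simple_exterior_path G K"


section \<open>Secular objects\<close>

definition bond_scattering ::
    "('v, 'e::finite) qgraph \<Rightarrow> complex ^ 'e bond ^ 'e bond" where
  "bond_scattering G = (\<chi> b b'.
     if terminus G b' \<noteq> origin G b then 0
     else if exterior G (origin G b) then
       (case bc G (origin G b) of Dirichlet \<Rightarrow> - 1 | Neumann \<Rightarrow> 1)
     else if b' = reverse_bond b then 2 / of_nat (vdegree G (origin G b)) - 1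
     else 2 / of_nat (vdegree G (origin G b)))"

definition bond_phase :: "angle ^ 'e::finite \<Rightarrow> complex ^ 'e bond ^ 'e bond" where
  "bond_phase \<theta> = (\<chi> b b'. if b = b' then cis_angle (\<theta> $ fst b) else 0)"

definition bond_evolution ::
    "('v, 'e::finite) qgraph \<Rightarrow> angle ^ 'e \<Rightarrow> complex ^ 'e bond ^ 'e bond" where
  "bond_evolution G \<theta> = bond_phase \<theta> ** bond_scattering G"

definition edge_intensity :: "'e::finite \<Rightarrow> complex ^ 'e bond \<Rightarrow> real" where
  "edge_intensity e a = (cmod (a $ (e, True)))\<^sup>2 + (cmod (a $ (e, False)))\<^sup>2"

definition secular_set :: "('v, 'e::finite) qgraph \<Rightarrow> (angle ^ 'e) set" where
  "secular_set G = {\<theta>. det (mat 1 - bond_evolution G \<theta>) = 0}"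

text \<open>
  \<open>vec.dim\<close> is the complex dimension. The matrix is unitary, so that geometric and algebraic
  multiplicity of its eigenvalue \<open>1\<close> agree.
\<close>

definition regular_supported_set ::
    "('v, 'e::finite) qgraph \<Rightarrow> 'e set \<Rightarrow> (angle ^ 'e) set" where
  "regular_supported_set G K = {\<theta> \<in> secular_set G.
     vec.dim {a. bond_evolution G \<theta> *v a = a} = 1 \<and>
     (\<exists>a. a \<noteq> 0 \<and> bond_evolution G \<theta> *v a = a \<and> (\<forall>e. edge_intensity e a > 0 \<longleftrightarrow> e \<in> K))}"

definition orbit_closure :: "real ^ 'e::finite \<Rightarrow> (angle ^ 'e) set" where
  "orbit_closure len = closure (range (\<lambda>k::real. \<chi> e. abs_angle (k * len $ e)))"

definition RAC :: "('v, 'e::finite) qgraph \<Rightarrow> 'e set \<Rightarrow> real ^ 'e \<Rightarrow> bool" where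
  "RAC G K len \<longleftrightarrow> orbit_closure len \<inter> regular_supported_set G K \<noteq> {}"

definition rationally_independent :: "real ^ 'e::finite \<Rightarrow> bool" where
  "rationally_independent len \<longleftrightarrow>
     (\<forall>m :: int ^ 'e. (\<Sum>e\<in>UNIV. of_int (m $ e) * len $ e) = 0 \<longrightarrow> m = 0)"


section \<open>The Laplacian\<close>

text \<open>
  A function on the metric graph is a family \<open>u :: 'e \<Rightarrow> real \<Rightarrow> 'a\<close>, of which only the values of
  \<open>u e\<close> on \<open>{0..len $ e}\<close> matter.

  \<open>H2_on L f f' f''\<close>: \<open>f\<close> is (the continuously differentiable representative of) an element of the
  Sobolev space \<open>H\<^sup>2(0,L)\<close>, with first derivative \<open>f'\<close> and weak second derivative \<open>f''\<close> in
  \<open>L\<^sup>2(0,L)\<close>.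
\<close>

definition H2_on ::
    "real \<Rightarrow> (real \<Rightarrow> complex) \<Rightarrow> (real \<Rightarrow> complex) \<Rightarrow> (real \<Rightarrow> complex) \<Rightarrow> bool" where
  "H2_on L f f' f'' \<longleftrightarrow>
     set_borel_measurable lborel {0..L} f'' \<and>
     set_integrable lborel {0..L} (\<lambda>x. (cmod (f'' x))\<^sup>2) \<and>
     (\<forall>x\<in>{0..L}. f' x = f' 0 + (LINT t:{0..x}|lborel. f'' t)) \<and>
     (\<forall>x\<in>{0..L}. f x = f 0 + (LINT t:{0..x}|lborel. f' t))"

text \<open>Value and derivative (in the direction of the bond) at the origin of a bond.\<close>

definition bond_value :: "real ^ 'e::finite \<Rightarrow> ('e \<Rightarrow> real \<Rightarrow> 'a) \<Rightarrow> 'e bond \<Rightarrow> 'a" where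
  "bond_value len u b = u (fst b) (if snd b then 0 else len $ fst b)"

definition bond_derivative ::
    "real ^ 'e::finite \<Rightarrow> ('e \<Rightarrow> real \<Rightarrow> complex) \<Rightarrow> 'e bond \<Rightarrow> complex" where
  "bond_derivative len u' b = (if snd b then u' (fst b) 0 else - u' (fst b) (len $ fst b))"

definition continuous_at_vertex ::
    "('v, 'e::finite) qgraph \<Rightarrow> real ^ 'e \<Rightarrow> ('e \<Rightarrow> real \<Rightarrow> 'a) \<Rightarrow> 'v \<Rightarrow> bool" where
  "continuous_at_vertex G len u v \<longleftrightarrow>
     (\<forall>b b'. origin G b = v \<and> origin G b' = v \<longrightarrow> bond_value len u b = bond_value len u b')"

definition vertex_condition ::
    "('v, 'e::finite) qgraph \<Rightarrow> real ^ 'e \<Rightarrow>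
     ('e \<Rightarrow> real \<Rightarrow> complex) \<Rightarrow> ('e \<Rightarrow> real \<Rightarrow> complex) \<Rightarrow> 'v \<Rightarrow> bool" where
  "vertex_condition G len u u' v \<longleftrightarrow>
     (if exterior G v then
        (case bc G v of
           Dirichlet \<Rightarrow> \<forall>b. origin G b = v \<longrightarrow> bond_value len u b = 0
         | Neumann \<Rightarrow> \<forall>b. origin G b = v \<longrightarrow> bond_derivative len u' b = 0)
      else
        continuous_at_vertex G len u v \<and> (\<Sum>b | origin G b = v. bond_derivative len u' b) = 0)"

text \<open>
  \<open>neg_laplacian G len u w\<close>: the function \<open>u\<close> lies in the domain of the operator and is mapped to
  \<open>w\<close>, where \<open>w\<close> is determined up to null sets.
\<close>

definition neg_laplacian ::
    "('v, 'e::finite) qgraph \<Rightarrow> real ^ 'e \<Rightarrow>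
     ('e \<Rightarrow> real \<Rightarrow> complex) \<Rightarrow> ('e \<Rightarrow> real \<Rightarrow> complex) \<Rightarrow> bool" where
  "neg_laplacian G len u w \<longleftrightarrow>
     (\<exists>u' u''. (\<forall>e. H2_on (len $ e) (u e) (u' e) (u'' e)) \<and>
        (\<forall>v. vertex_condition G len u u' v) \<and>
        (\<forall>e. AE x in lborel. x \<in> {0..len $ e} \<longrightarrow> w e x = - u'' e x))"


section \<open>Norms and weak convergence\<close>

definition L2_norm_on ::
    "real ^ 'e::finite \<Rightarrow> 'e set \<Rightarrow> ('e \<Rightarrow> real \<Rightarrow> complex) \<Rightarrow> real" where
  "L2_norm_on len A u = sqrt (\<Sum>e\<in>A. LINT x:{0..len $ e}|lborel. (cmod (u e x))\<^sup>2)"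

definition continuous_on_graph ::
    "('v, 'e::finite) qgraph \<Rightarrow> real ^ 'e \<Rightarrow> ('e \<Rightarrow> real \<Rightarrow> real) \<Rightarrow> bool" where
  "continuous_on_graph G len \<phi> \<longleftrightarrow>
     (\<forall>e. continuous_on {0..len $ e} (\<phi> e)) \<and> (\<forall>v. continuous_at_vertex G len \<phi> v)"

text \<open>Weak convergence of the measures \<open>\<rho>\<^sub>n dx\<close> to \<open>\<rho> dx\<close> on the compact metric graph.\<close>

definition densities_converge_weakly ::
    "('v, 'e::finite) qgraph \<Rightarrow> real ^ 'e \<Rightarrow>
     (nat \<Rightarrow> 'e \<Rightarrow> real \<Rightarrow> real) \<Rightarrow> ('e \<Rightarrow> real \<Rightarrow> real) \<Rightarrow> bool" where
  "densities_converge_weakly G len \<rho>s \<rho> \<longleftrightarrow>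
     (\<forall>\<phi>. continuous_on_graph G len \<phi> \<longrightarrow>
        (\<lambda>n. \<Sum>e\<in>UNIV. LINT x:{0..len $ e}|lborel. \<phi> e x * \<rho>s n e x)
          \<longlonglongrightarrow> (\<Sum>e\<in>UNIV. LINT x:{0..len $ e}|lborel. \<phi> e x * \<rho> e x))"

end

(* On K the mode is a sine wave that vanishes at all vertices of K except Neumann ends; an edge with
   such an end is a quarter wave longer or shorter. The bond phases on K are thereby fixed, while those
   off K are still free. If they are set to 0, the evolution is a strict contraction off K, so every fixed
   vector lives on K, and since K is proper the mode is the only one. Simplicity of the eigenvalue 1 is
   therefore the nonvanishing of a polynomial in the off-K phase z, nonzero at z = 0, hence nonzero at
   some z on the unit circle.

   By Kronecker's theorem the orbit of the lengths comes close to this point of the torus at arbitrarily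
   high frequencies. The secular determinant along the orbit, in a complex shift of the frequency, has
   only real zeros, because the evolution contracts or expands off the real axis; so Hurwitz's theorem
   produces exact eigenvalues nearby. The bond amplitudes converge to the mode by compactness and
   simplicity, and the interference of the two bonds of an edge disappears by the Riemann-Lebesgue
   lemma. *)

theory Submission
  imports Defs "HOL-Complex_Analysis.Great_Picard" "HOL-Analysis.Kronecker_Approximation_Theorem"
begin

section \<open>Scattering at the vertices\<close>

text \<open>Why properness matters: on a cycle all prescribed phases are 1, and these admit the
  cosine beside the sine. The cosine is excluded only by a vertex that K shares with an edge off K:
  the vertex value is constant along the cycle, and it is zero there because nothing enters or
  leaves that edge. Why a deflated matrix: the mode is a fixed vector for every off-K phase z, so
  det(I - U) vanishes identically in z and says nothing about simplicity. A rank-one term built from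
  the mode removes exactly this common kernel; it does no other harm because the mode is a left
  fixed vector as well. Simplicity is used twice: it is part of \<open>RAC\<close>, and it forces
  every limit of eigenvectors along the orbit to be a multiple of the mode. Why Hurwitz: orbit
  points close to the chosen torus point need not lie on the secular set, whereas exact
  eigenfunctions are wanted. No derivative of the determinant has to be computed; it suffices that
  it is not constant in the shift. Kronecker's theorem controls neither the size nor the sign of the
  time it gives, so a late return time of the orbit is added to it.\<close>

lemma reverse_bond_reverse [simp]: "reverse_bond (reverse_bond b) = b"
  by (simp add: reverse_bond_def)

lemma reverse_bond_neq [simp]: "reverse_bond b \<noteq> b" "b \<noteq> reverse_bond b"
  by (auto simp: reverse_bond_def prod_eq_iff)

lemma fst_reverse_bond [simp]: "fst (reverse_bond b) = fst b"
  by (simp add: reverse_bond_def)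

lemma origin_reverse_bond [simp]: "origin G (reverse_bond b) = terminus G b"
  by (simp add: reverse_bond_def origin_def terminus_def)

lemma terminus_reverse_bond [simp]: "terminus G (reverse_bond b) = origin G b"
  by (simp add: reverse_bond_def origin_def terminus_def)

lemma bond_cases: "fst b = fst b' \<Longrightarrow> b = b' \<or> b = reverse_bond b'"
  by (auto simp: reverse_bond_def prod_eq_iff)

lemma sum_reverse_bond: "(\<Sum>b\<in>UNIV. f (reverse_bond b)) = (\<Sum>b\<in>UNIV. f (b :: 'e::finite bond))"
  by (rule sum.reindex_bij_witness[of _ reverse_bond reverse_bond]) auto

lemma sum_origin_reverse:
  "(\<Sum>b | origin G b = v. f (reverse_bond b)) = (\<Sum>b | terminus G b = v. f b)"
  for f :: "'e::finite bond \<Rightarrow> 'a::comm_monoid_add"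
  by (rule sum.reindex_bij_witness[of _ reverse_bond reverse_bond]) auto

lemma card_terminus: "card {b. terminus G b = v} = vdegree G v"
proof -
  have "{b. terminus G b = v} = (\<lambda>e. (e, False)) ` {e. tail G e = v} \<union> (\<lambda>e. (e, True)) ` {e. head G e = v}"
    by (auto simp: terminus_def image_iff split: if_splits)
  moreover have "card \<dots> = card {e. tail G e = v} + card {e. head G e = v}"
    by (subst card_Un_disjoint) (auto simp: card_image inj_on_def)
  ultimately show ?thesis
    by (simp add: vdegree_def)
qed

lemma card_origin: "card {b. origin G b = v} = vdegree G v"
  unfolding card_terminus[symmetric]
  by (intro bij_betw_same_card[of reverse_bond] bij_betw_byWitness[where f' = reverse_bond]) auto

lemma vdegree_origin_pos: "vdegree G (origin G b) > 0"
  by (metis (mono_tags, lifting) card_gt_0_iff card_origin empty_iff finite mem_Collect_eq)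

lemma exterior_terminus_unique:
  assumes "exterior G v" "terminus G b = v" "terminus G b' = v"
  shows "b = b'"
proof -
  have "card {b. terminus G b = v} = 1"
    using assms by (simp add: card_terminus exterior_def)
  then show ?thesis
    using assms by (metis (mono_tags, lifting) card_1_singletonE mem_Collect_eq singletonD)
qed

lemma exterior_terminus_set:
  assumes "exterior G (origin G b)"
  shows "{b'. terminus G b' = origin G b} = {reverse_bond b}"
  using exterior_terminus_unique[OF assms, of _ "reverse_bond b"] by (auto simp: set_eq_iff)

definition dirichlet_vertex :: "('v, 'e::finite) qgraph \<Rightarrow> 'v \<Rightarrow> bool" where
  "dirichlet_vertex G v \<longleftrightarrow> exterior G v \<and> bc G v = Dirichlet"

definition neumann_vertex :: "('v, 'e::finite) qgraph \<Rightarrow> 'v \<Rightarrow> bool" where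
  "neumann_vertex G v \<longleftrightarrow> exterior G v \<and> bc G v = Neumann"

text \<open>
  The value at \<open>v\<close> of the function with incoming amplitudes \<open>a\<close>. A Neumann vertex obeys the Kirchhoff
  rule in degree one.
\<close>

definition vertex_amplitude ::
    "('v, 'e::finite) qgraph \<Rightarrow> complex ^ 'e bond \<Rightarrow> 'v \<Rightarrow> complex" where
  "vertex_amplitude G a v =
     (if dirichlet_vertex G v then 0
      else 2 / of_nat (vdegree G v) * (\<Sum>b | terminus G b = v. a $ b))"

text \<open>In degree one the Kirchhoff entry 2/d - 1 equals the Neumann value 1, and a zero vertex
  amplitude gives the Dirichlet value -1. Hence one formula covers all cases: outgoing and incoming
  wave on an edge add up to the value at the vertex.\<close>

lemma scattering_nth:
  "(bond_scattering G *v a) $ b = vertex_amplitude G a (origin G b) - a $ reverse_bond b"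
proof -
  define v where "v = origin G b"
  have split: "(\<Sum>b'\<in>UNIV. (if terminus G b' = v then c else 0) * a $ b')
      = c * (\<Sum>b' | terminus G b' = v. a $ b')" for c :: complex
  proof -
    have "(\<Sum>b'\<in>UNIV. (if terminus G b' = v then c else 0) * a $ b')
        = (\<Sum>b'\<in>UNIV. if terminus G b' = v then c * a $ b' else 0)"
      by (intro sum.cong) auto
    also have "\<dots> = (\<Sum>b' | terminus G b' = v. c * a $ b')"
      by (simp add: sum.If_cases)
    finally show ?thesis
      by (simp add: sum_distrib_left)
  qed
  have S: "(bond_scattering G *v a) $ b = (\<Sum>b'\<in>UNIV. bond_scattering G $ b $ b' * a $ b')"
    by (simp add: matrix_vector_mult_def)
  show ?thesis
  proof (cases "exterior G v")
    case True
    define c :: complex where "c = (case bc G v of Dirichlet \<Rightarrow> -1 | Neumann \<Rightarrow> 1)"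
    have *: "bond_scattering G $ b $ b' = (if terminus G b' = v then c else 0)" for b'
      using True by (auto simp: bond_scattering_def v_def c_def split: boundary_condition.splits)
    have sum: "(\<Sum>b' | terminus G b' = v. a $ b') = a $ reverse_bond b"
      using exterior_terminus_set[of G b] True by (simp add: v_def)
    have deg: "vdegree G v = 1"
      using True by (simp add: exterior_def)
    show ?thesis
      unfolding S * split sum
      by (cases "bc G v")
         (use True sum deg in \<open>simp_all add: vertex_amplitude_def dirichlet_vertex_def c_def flip: v_def\<close>)
  next
    case False
    define c :: complex where "c = 2 / of_nat (vdegree G v)"
    have *: "bond_scattering G $ b $ b' * a $ b'
       = (if terminus G b' = v then c else 0) * a $ b' - (if b' = reverse_bond b then a $ b' else 0)" for b'
      using False by (auto simp: bond_scattering_def v_def c_def ring_distribs)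
    show ?thesis
      unfolding S * sum_subtractf split
      using False by (simp add: vertex_amplitude_def dirichlet_vertex_def c_def flip: v_def)
  qed
qed

text \<open>Grouped by the vertex at which they arrive, amplitudes are mapped by the reflection 2P -
  I, where P is the averaging projection, or 0 at a Dirichlet vertex. Reversing the bonds only
  permutes entries.\<close>

lemma scattering_isometry:
  fixes G :: "('v::finite, 'e::finite) qgraph"
  shows "(\<Sum>b\<in>UNIV. cnj ((bond_scattering G *v x) $ b) * (bond_scattering G *v y) $ b)
    = (\<Sum>b\<in>UNIV. cnj (x $ b) * y $ b)"
proof -
  let ?c = "vertex_amplitude G"
  have vertex: "(\<Sum>b | terminus G b = v. cnj (?c x v - x $ b) * (?c y v - y $ b))
      = (\<Sum>b | terminus G b = v. cnj (x $ b) * y $ b)" for v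
  proof (cases "dirichlet_vertex G v \<or> {b. terminus G b = v} = {}")
    case True
    then show ?thesis
    proof
      assume "dirichlet_vertex G v"
      then show ?thesis
        by (simp add: vertex_amplitude_def)
    qed (simp del: Collect_empty_eq)
  next
    case False
    define X where "X = (\<Sum>b | terminus G b = v. x $ b)"
    define Y where "Y = (\<Sum>b | terminus G b = v. y $ b)"
    define d :: complex where "d = of_nat (vdegree G v)"
    have d0: "d \<noteq> 0"
      using False by (simp add: d_def card_eq_0_iff flip: card_terminus)
    have c: "?c x v = 2 / d * X" "?c y v = 2 / d * Y"
      using False by (simp_all add: vertex_amplitude_def d_def X_def Y_def)
    have "(\<Sum>b | terminus G b = v. cnj (?c x v - x $ b) * (?c y v - y $ b))
      = (\<Sum>b | terminus G b = v. cnj (?c x v) * ?c y v - cnj (?c x v) * y $ b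
          - ?c y v * cnj (x $ b) + cnj (x $ b) * y $ b)"
      by (intro sum.cong) (auto simp: algebra_simps)
    also have "\<dots> = d * cnj (?c x v) * ?c y v - cnj (?c x v) * Y - ?c y v * cnj X
          + (\<Sum>b | terminus G b = v. cnj (x $ b) * y $ b)"
      by (simp add: sum.distrib sum_subtractf card_terminus d_def X_def Y_def sum_distrib_left)
    \<comment> \<open>The three terms are 4/d, -2/d and -2/d times \<open>cnj X * Y\<close>.\<close>
    also have "d * cnj (?c x v) * ?c y v - cnj (?c x v) * Y - ?c y v * cnj X = 0"
      using d0 by (simp add: c field_simps) (simp add: d_def)
    finally show ?thesis
      by simp
  qed
  have "(\<Sum>b\<in>UNIV. cnj ((bond_scattering G *v x) $ b) * (bond_scattering G *v y) $ b)
    = (\<Sum>b\<in>UNIV. cnj ((bond_scattering G *v x) $ reverse_bond b) * (bond_scattering G *v y) $ reverse_bond b)"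
    by (rule sum_reverse_bond[symmetric])
  also have "\<dots> = (\<Sum>b\<in>UNIV. cnj (?c x (terminus G b) - x $ b) * (?c y (terminus G b) - y $ b))"
    by (simp add: scattering_nth)
  also have "\<dots> = (\<Sum>v\<in>UNIV. \<Sum>b | b \<in> UNIV \<and> terminus G b = v.
      cnj (?c x (terminus G b) - x $ b) * (?c y (terminus G b) - y $ b))"
    by (rule sum.group[symmetric]) auto
  also have "\<dots> = (\<Sum>v\<in>UNIV. \<Sum>b | b \<in> UNIV \<and> terminus G b = v. cnj (x $ b) * y $ b)"
  proof (rule sum.cong)
    fix v
    have "(\<Sum>b | terminus G b = v. cnj (?c x (terminus G b) - x $ b) * (?c y (terminus G b) - y $ b))
        = (\<Sum>b | terminus G b = v. cnj (?c x v - x $ b) * (?c y v - y $ b))"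
      by (intro sum.cong) auto
    then show "(\<Sum>b | b \<in> UNIV \<and> terminus G b = v.
          cnj (?c x (terminus G b) - x $ b) * (?c y (terminus G b) - y $ b))
        = (\<Sum>b | b \<in> UNIV \<and> terminus G b = v. cnj (x $ b) * y $ b)"
      using vertex[of v] by simp
  qed simp
  also have "\<dots> = (\<Sum>b\<in>UNIV. cnj (x $ b) * y $ b)"
    by (rule sum.group) auto
  finally show ?thesis .
qed

lemma scattering_norm:
  fixes G :: "('v::finite, 'e::finite) qgraph"
  shows "(\<Sum>b\<in>UNIV. (cmod ((bond_scattering G *v x) $ b))\<^sup>2) = (\<Sum>b\<in>UNIV. (cmod (x $ b))\<^sup>2)"
proof -
  have "complex_of_real (\<Sum>b\<in>UNIV. (cmod ((bond_scattering G *v x) $ b))\<^sup>2)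
      = of_real (\<Sum>b\<in>UNIV. (cmod (x $ b))\<^sup>2)"
    using scattering_isometry[of G x x] by (simp only: of_real_sum complex_norm_square mult.commute)
  then show ?thesis
    using of_real_eq_iff by blast
qed


section \<open>Fixed vectors\<close>

text \<open>
  The edge phases \<open>w\<close> range over all complex numbers here: the perturbation arguments below leave
  the torus.
\<close>

definition bond_fixed :: "('v, 'e::finite) qgraph \<Rightarrow> complex ^ 'e \<Rightarrow> complex ^ 'e bond \<Rightarrow> bool" where
  "bond_fixed G w a \<longleftrightarrow> (\<forall>b. a $ b = w $ fst b * (bond_scattering G *v a) $ b)"

definition secular_matrix :: "('v, 'e::finite) qgraph \<Rightarrow> complex ^ 'e \<Rightarrow> complex ^ 'e bond ^ 'e bond" where
  "secular_matrix G w = (\<chi> b b'. mat 1 $ b $ b' - w $ fst b * bond_scattering G $ b $ b')"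

lemma det_eq_0_iff_kernel: "det A = 0 \<longleftrightarrow> (\<exists>x. x \<noteq> 0 \<and> A *v x = 0)"
  for A :: "'a::field ^ 'n ^ 'n"
  by (metis invertible_det_nz invertible_left_inverse matrix_left_invertible_ker)

lemma secular_matrix_mult_nth:
  "(secular_matrix G w *v a) $ b = a $ b - w $ fst b * (bond_scattering G *v a) $ b"
proof -
  have "(secular_matrix G w *v a) $ b = (mat 1 *v a) $ b - w $ fst b * (bond_scattering G *v a) $ b"
    by (simp only: secular_matrix_def matrix_vector_mult_def vec_lambda_beta left_diff_distrib
        sum_subtractf sum_distrib_left mult.assoc)
  then show ?thesis
    by simp
qed

lemma bond_fixed_iff_kernel: "bond_fixed G w a \<longleftrightarrow> secular_matrix G w *v a = 0"
  by (auto simp: bond_fixed_def vec_eq_iff secular_matrix_mult_nth)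

lemma det_secular_matrix_eq_0_iff:
  "det (secular_matrix G w) = 0 \<longleftrightarrow> (\<exists>a. a \<noteq> 0 \<and> bond_fixed G w a)"
  by (simp add: det_eq_0_iff_kernel bond_fixed_iff_kernel)

lemma bond_fixed_diff_scale:
  assumes "bond_fixed G w a" "bond_fixed G w a'"
  shows "bond_fixed G w (a - c *s a')"
  using assms unfolding bond_fixed_iff_kernel
  by (simp add: matrix_vector_mult_diff_distrib matrix_vector_mult_scaleR vec.scale)

lemma bond_fixed_scale: "bond_fixed G w a \<Longrightarrow> bond_fixed G w (c *s a)"
  unfolding bond_fixed_iff_kernel by (simp add: vec.scale)

lemma bond_evolution_nth:
  "(bond_evolution G \<theta> *v a) $ b = cis_angle (\<theta> $ fst b) * (bond_scattering G *v a) $ b"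
proof -
  have "(bond_phase \<theta> *v x) $ b = (\<Sum>b'\<in>UNIV. if b = b' then cis_angle (\<theta> $ fst b) * x $ b' else 0)" for x
    unfolding bond_phase_def matrix_vector_mult_def vec_lambda_beta by (rule sum.cong) auto
  then show ?thesis
    by (simp add: bond_evolution_def flip: matrix_vector_mul_assoc)
qed

lemma bond_evolution_fixed_iff:
  "bond_evolution G \<theta> *v a = a \<longleftrightarrow> bond_fixed G (\<chi> e. cis_angle (\<theta> $ e)) a"
  by (simp add: bond_fixed_def vec_eq_iff bond_evolution_nth eq_commute)

lemma secular_set_iff: "\<theta> \<in> secular_set G \<longleftrightarrow> (\<exists>a. a \<noteq> 0 \<and> bond_evolution G \<theta> *v a = a)"
  unfolding secular_set_def mem_Collect_eq det_eq_0_iff_kernel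
  by (intro arg_cong[where f = Ex] ext) (auto simp: matrix_vector_mult_diff_rdistrib)

text \<open>Scattering preserves the total energy and the passage of an edge multiplies it by the
  squared modulus of \<open>w\<close>; in a fixed vector gains and losses cancel.\<close>

lemma bond_fixed_balance:
  fixes G :: "('v::finite, 'e::finite) qgraph"
  assumes "bond_fixed G w a"
  shows "(\<Sum>b\<in>UNIV. (1 - (cmod (w $ fst b))\<^sup>2) * (cmod ((bond_scattering G *v a) $ b))\<^sup>2) = 0"
proof -
  have "(cmod (a $ b))\<^sup>2 = (cmod (w $ fst b))\<^sup>2 * (cmod ((bond_scattering G *v a) $ b))\<^sup>2" for b
    using assms unfolding bond_fixed_def by (metis norm_mult power_mult_distrib)
  then show ?thesis
    using scattering_norm[of G a] by (simp add: left_diff_distrib sum_subtractf)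
qed

text \<open>If no edge amplifies, all terms of the balance are nonnegative. The conclusion is about
  the scattered amplitude: where \<open>w $ e = 0\<close>, the vanishing of \<open>a\<close> is
  trivial, while this one forces the vertex amplitudes at the ends of the edge to vanish.\<close>

lemma bond_fixed_contraction:
  fixes G :: "('v::finite, 'e::finite) qgraph"
  assumes "bond_fixed G w a" and "\<And>e. cmod (w $ e) \<le> 1" and "cmod (w $ fst b) < 1"
  shows "(bond_scattering G *v a) $ b = 0"
proof -
  have "\<forall>b\<in>UNIV. (1 - (cmod (w $ fst b))\<^sup>2) * (cmod ((bond_scattering G *v a) $ b))\<^sup>2 = 0"
    using assms(2) bond_fixed_balance[OF assms(1)]
    by (subst (asm) sum_nonneg_eq_0_iff) (auto simp: power_le_one)
  moreover have "(cmod (w $ fst b))\<^sup>2 < 1"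
    using assms(3) by (simp add: abs_square_less_1)
  ultimately show ?thesis
    using UNIV_I[of b] by (metis diff_gt_0_iff_gt less_irrefl mult_eq_0_iff norm_eq_zero power_eq_0_iff)
qed

lemma bond_fixed_expansion:
  fixes G :: "('v::finite, 'e::finite) qgraph"
  assumes "bond_fixed G w a" and "\<And>e. cmod (w $ e) > 1"
  shows "a = 0"
proof -
  have gt: "1 < (cmod (w $ e))\<^sup>2" for e
    using assms(2)[of e] by (simp add: one_less_power)
  have "(\<Sum>b\<in>UNIV. ((cmod (w $ fst b))\<^sup>2 - 1) * (cmod ((bond_scattering G *v a) $ b))\<^sup>2) = 0"
    using bond_fixed_balance[OF assms(1)] by (simp add: left_diff_distrib sum_subtractf)
  then have "\<forall>b\<in>UNIV. ((cmod (w $ fst b))\<^sup>2 - 1) * (cmod ((bond_scattering G *v a) $ b))\<^sup>2 = 0"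
    using gt by (subst (asm) sum_nonneg_eq_0_iff) (auto simp: less_imp_le)
  then have "(bond_scattering G *v a) $ b = 0" for b
    using gt[of "fst b"] UNIV_I[of b]
    by (metis diff_gt_0_iff_gt less_irrefl mult_eq_0_iff norm_eq_zero power_eq_0_iff)
  then show ?thesis
    using assms(1) by (simp add: bond_fixed_def vec_eq_iff)
qed


section \<open>The mode carried by a primitive subgraph\<close>

text \<open>Cycles and exterior paths are treated together. Origins and termini are distinct
  separately, which lets the last terminus coincide with the first origin.\<close>

definition simple_walk :: "('v, 'e::finite) qgraph \<Rightarrow> 'e bond list \<Rightarrow> bool" where
  "simple_walk G bs \<longleftrightarrow>
     bs \<noteq> [] \<and> successively (\<lambda>b b'. terminus G b = origin G b') bs \<and>
     distinct (map (origin G) bs) \<and> distinct (map (terminus G) bs) \<and> distinct (map fst bs) \<and>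
     (terminus G (last bs) = origin G (hd bs) \<or>
      exterior G (origin G (hd bs)) \<and> exterior G (terminus G (last bs)))"

lemma walk_vertices:
  assumes "bs \<noteq> []" "successively (\<lambda>b b'. terminus G b = origin G b') bs"
  shows "origin G (hd bs) # map (terminus G) bs = map (origin G) bs @ [terminus G (last bs)]"
  using assms
proof (induction bs)
  case (Cons b bs)
  then show ?case
    by (cases bs) auto
qed simp

lemma simple_cycle_imp_walk:
  assumes "simple_cycle G K"
  shows "\<exists>bs. simple_walk G bs \<and> K = fst ` set bs"
proof -
  obtain bs where bs: "bs \<noteq> []" "successively (\<lambda>b b'. terminus G b = origin G b') bs"
    "terminus G (last bs) = origin G (hd bs)" "distinct (map (origin G) bs)" "distinct (map fst bs)"
    "K = fst ` set bs"
    using assms unfolding simple_cycle_def by blast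
  \<comment> \<open>On a closed walk the termini are the origins shifted by one place.\<close>
  have "map (terminus G) bs = rotate1 (map (origin G) bs)"
    using walk_vertices[OF bs(1,2)] bs(1,3) by (cases bs) auto
  then have "distinct (map (terminus G) bs)"
    using bs(4) by (metis distinct1_rotate)
  with bs show ?thesis
    unfolding simple_walk_def by blast
qed

text \<open>Distinct edges have to be derived from distinct vertices: two passages of an edge in the
  same direction repeat a vertex, and in opposite directions each would have to be the immediate
  successor of the other.\<close>

lemma simple_exterior_path_imp_walk:
  assumes "simple_exterior_path G K"
  shows "\<exists>bs. simple_walk G bs \<and> K = fst ` set bs"
proof -
  obtain bs where bs: "bs \<noteq> []" "successively (\<lambda>b b'. terminus G b = origin G b') bs"
    "distinct (origin G (hd bs) # map (terminus G) bs)"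
    "exterior G (origin G (hd bs))" "exterior G (terminus G (last bs))" "K = fst ` set bs"
    using assms unfolding simple_exterior_path_def by blast
  define vs where "vs = origin G (hd bs) # map (terminus G) bs"
  have vs: "vs = map (origin G) bs @ [terminus G (last bs)]"
    unfolding vs_def by (rule walk_vertices) fact+
  have dist: "distinct vs" and len: "length vs = Suc (length bs)"
    using bs(3) by (simp_all add: vs_def)
  have o: "vs ! i = origin G (bs ! i)" and t: "vs ! Suc i = terminus G (bs ! i)" if "i < length bs" for i
    using that by (simp add: vs nth_append) (use that in \<open>simp add: vs_def\<close>)
  have "i = j" if ij: "i < length bs" "j < length bs" "fst (bs ! i) = fst (bs ! j)" for i j
  proof -
    have "bs ! i = bs ! j \<or> bs ! i = reverse_bond (bs ! j)"
      using bond_cases ij(3) by blast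
    then show ?thesis
    proof
      assume "bs ! i = bs ! j"
      then have "vs ! i = vs ! j"
        using o ij by simp
      then show ?thesis
        using dist len ij by (simp add: nth_eq_iff_index_eq)
    next
      assume "bs ! i = reverse_bond (bs ! j)"
      then have "vs ! i = vs ! Suc j" "vs ! Suc i = vs ! j"
        using o t ij by simp_all
      then have "i = Suc j" "Suc i = j"
        using dist len ij by (simp_all add: nth_eq_iff_index_eq)
      then show ?thesis
        by simp
    qed
  qed
  then have "distinct (map fst bs)"
    by (simp add: distinct_conv_nth) blast
  moreover have "distinct (map (origin G) bs)"
    using dist by (simp add: vs)
  ultimately show ?thesis
    using bs unfolding simple_walk_def by auto
qed

lemma primitive_subgraph_imp_walk:
  "primitive_subgraph G K \<Longrightarrow> \<exists>bs. simple_walk G bs \<and> K = fst ` set bs"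
  unfolding primitive_subgraph_def
  using simple_cycle_imp_walk simple_exterior_path_imp_walk by blast

text \<open>The unit flow along the walk. Its antisymmetry under reversal gives the two bonds of an
  edge opposite waves, which form a sine.\<close>

definition walk_flow :: "'e bond list \<Rightarrow> 'e bond \<Rightarrow> complex" where
  "walk_flow bs b = of_bool (b \<in> set bs) - of_bool (reverse_bond b \<in> set bs)"

definition end_phase :: "('v, 'e::finite) qgraph \<Rightarrow> 'v \<Rightarrow> complex" where
  "end_phase G v = (if neumann_vertex G v then \<i> else 1)"

text \<open>
  At these phases sine waves vanishing at all inner vertices of the walk fit onto its edges; a Neumann
  end shifts the phase by \<open>\<pi>/2\<close>.
\<close>

definition walk_phase :: "('v, 'e::finite) qgraph \<Rightarrow> 'e \<Rightarrow> complex" where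
  "walk_phase G e = end_phase G (tail G e) * end_phase G (head G e)"

definition walk_mode :: "('v, 'e::finite) qgraph \<Rightarrow> 'e bond list \<Rightarrow> complex ^ 'e bond" where
  "walk_mode G bs = (\<chi> b. walk_flow bs b * end_phase G (terminus G b))"

lemma walk_phase_bond: "walk_phase G (fst b) = end_phase G (origin G b) * end_phase G (terminus G b)"
  by (simp add: walk_phase_def origin_def terminus_def)

lemma norm_end_phase [simp]: "cmod (end_phase G v) = 1"
  by (simp add: end_phase_def)

lemma norm_walk_phase [simp]: "cmod (walk_phase G e) = 1"
  by (simp add: walk_phase_def norm_mult)

lemma walk_flow_reverse [simp]: "walk_flow bs (reverse_bond b) = - walk_flow bs b"
  by (simp add: walk_flow_def)

lemma walk_not_reverse:
  assumes "distinct (map fst bs)" "b \<in> set bs"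
  shows "reverse_bond b \<notin> set bs"
  using assms by (metis distinct_map fst_reverse_bond inj_onD reverse_bond_neq(1))

lemma in_walk_edges_iff: "fst b \<in> fst ` set bs \<longleftrightarrow> b \<in> set bs \<or> reverse_bond b \<in> set bs"
proof
  assume "fst b \<in> fst ` set bs"
  then obtain b' where "b' \<in> set bs" "fst b = fst b'"
    by blast
  then show "b \<in> set bs \<or> reverse_bond b \<in> set bs"
    using bond_cases[of b b'] by auto
next
  assume "b \<in> set bs \<or> reverse_bond b \<in> set bs"
  then show "fst b \<in> fst ` set bs"
    using fst_reverse_bond[of b] by (metis imageI)
qed

lemma norm_walk_flow:
  assumes "distinct (map fst bs)"
  shows "cmod (walk_flow bs b) = of_bool (fst b \<in> fst ` set bs)"
  using walk_not_reverse[OF assms, of b] by (auto simp: walk_flow_def in_walk_edges_iff)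

lemma norm_walk_mode:
  assumes "distinct (map fst bs)"
  shows "cmod (walk_mode G bs $ b) = of_bool (fst b \<in> fst ` set bs)"
  by (simp add: walk_mode_def norm_mult norm_walk_flow[OF assms])

text \<open>Distinctness lets the walk enter and leave a vertex at most once, and a vertex that is
  not exterior can be an end of the walk only if the walk is closed; so it is entered iff it is
  left.\<close>

lemma walk_flow_conservation:
  assumes walk: "simple_walk G bs" and v: "\<not> exterior G v"
  shows "(\<Sum>b | terminus G b = v. walk_flow bs b) = 0"
proof -
  have count: "(\<Sum>b | f b = v. of_bool (b \<in> set bs)) = (of_bool (v \<in> f ` set bs) :: complex)"
    if "distinct (map f bs)" for f
  proof (cases "v \<in> f ` set bs")
    case True
    then obtain b0 where "b0 \<in> set bs" "v = f b0"
      by blast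
    with that have "{b. f b = v} \<inter> set bs = {b0}"
      by (auto simp: distinct_map dest: inj_onD)
    with True show ?thesis
      by (simp add: sum.If_cases of_bool_def)
  next
    case False
    then show ?thesis
      by (auto intro!: sum.neutral)
  qed
  have "insert (origin G (hd bs)) (terminus G ` set bs) = insert (terminus G (last bs)) (origin G ` set bs)"
    using arg_cong[OF walk_vertices[of bs G], of set] walk by (simp add: simple_walk_def)
  moreover have "hd bs \<in> set bs" "last bs \<in> set bs"
    using walk by (simp_all add: simple_walk_def)
  moreover have "terminus G (last bs) = origin G (hd bs) \<or> v \<noteq> origin G (hd bs) \<and> v \<noteq> terminus G (last bs)"
    using walk v by (auto simp: simple_walk_def)
  ultimately have "v \<in> terminus G ` set bs \<longleftrightarrow> v \<in> origin G ` set bs"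
    by (metis (no_types, lifting) imageI insert_iff)
  then show ?thesis
    using walk count[of "terminus G"] count[of "origin G"]
      sum_origin_reverse[where G = G and v = v and f = "\<lambda>b. of_bool (reverse_bond b \<in> set bs) :: complex"]
    by (simp add: walk_flow_def sum_subtractf simple_walk_def del: sum_of_bool_eq)
qed

lemma scattering_neumann:
  assumes "neumann_vertex G (origin G b)"
  shows "(bond_scattering G *v a) $ b = a $ reverse_bond b"
proof -
  have "exterior G (origin G b)" "\<not> dirichlet_vertex G (origin G b)" "vdegree G (origin G b) = 1"
    using assms by (auto simp: neumann_vertex_def dirichlet_vertex_def exterior_def)
  then show ?thesis
    by (simp add: scattering_nth vertex_amplitude_def exterior_terminus_set)
qed

text \<open>Vertex amplitudes vanish at Dirichlet vertices by definition and at interior vertices by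
  conservation. So every bond starts with \<open>walk_flow\<close> divided by the phase of its
  origin, and \<open>walk_phase\<close> turns this into \<open>walk_flow\<close> times the phase of
  its terminus. No wave enters an edge off the walk, which leaves \<open>w\<close> free
  there.\<close>

lemma bond_fixed_walk_mode:
  assumes walk: "simple_walk G bs" and w: "\<And>e. e \<in> fst ` set bs \<Longrightarrow> w $ e = walk_phase G e"
  shows "bond_fixed G w (walk_mode G bs)"
  unfolding bond_fixed_def
proof
  fix b
  let ?a = "walk_mode G bs" and ?s = "walk_flow bs b" and ?o = "origin G b"
  have rev: "?a $ reverse_bond b = - ?s * end_phase G ?o"
    by (simp add: walk_mode_def)
  have S: "(bond_scattering G *v ?a) $ b = (if neumann_vertex G ?o then - \<i> * ?s else ?s)"
  proof (cases "neumann_vertex G ?o")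
    case True
    then show ?thesis
      by (simp add: scattering_neumann rev end_phase_def)
  next
    case False
    have "vertex_amplitude G ?a ?o = 0"
    proof (cases "exterior G ?o")
      case True
      with False have "dirichlet_vertex G ?o"
        by (cases "bc G ?o") (auto simp: dirichlet_vertex_def neumann_vertex_def)
      then show ?thesis
        by (simp add: vertex_amplitude_def)
    next
      case ext: False
      have "(\<Sum>b | terminus G b = ?o. ?a $ b) = (\<Sum>b | terminus G b = ?o. walk_flow bs b)"
        using False by (intro sum.cong) (auto simp: walk_mode_def end_phase_def)
      also have "\<dots> = 0"
        using walk_flow_conservation[OF walk ext] .
      finally show ?thesis
        by (simp add: vertex_amplitude_def)
    qed
    with False show ?thesis
      by (simp add: scattering_nth rev end_phase_def)
  qed
  show "?a $ b = w $ fst b * (bond_scattering G *v ?a) $ b"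
  proof (cases "fst b \<in> fst ` set bs")
    case True
    then show ?thesis
      unfolding S w[OF True] walk_phase_bond by (simp add: walk_mode_def end_phase_def)
  next
    case False
    then have "?s = 0"
      by (simp add: walk_flow_def in_walk_edges_iff)
    then show ?thesis
      by (simp add: S) (simp add: walk_mode_def)
  qed
qed

section \<open>Uniqueness of the mode\<close>

lemma successively_constant:
  assumes "successively (\<lambda>x y. f x = f y) xs" "x \<in> set xs"
  shows "f x = f (hd xs)"
  using assms
proof (induction xs)
  case (Cons y xs)
  then show ?case
    by (cases xs) auto
qed simp

text \<open>Otherwise the vertices of the walk are closed under adjacency, so by connectedness they
  are all vertices, and every edge lies on the walk.\<close>

lemma walk_leaves_proper_subgraph:
  assumes conn: "connected_graph G" and walk: "simple_walk G bs" and "fst ` set bs \<noteq> UNIV"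
  shows "\<exists>b b'. fst b \<notin> fst ` set bs \<and> fst b' \<in> fst ` set bs \<and> origin G b = origin G b'"
proof (rule ccontr)
  let ?K = "fst ` set bs"
  assume neg: "\<not> ?thesis"
  define V where "V = origin G ` {b. fst b \<in> ?K}"
  have step: "terminus G b \<in> V" if "origin G b \<in> V" for b
  proof -
    have "fst b \<in> ?K"
      using neg that unfolding V_def by blast
    then have "fst (reverse_bond b) \<in> ?K"
      by simp
    then show ?thesis
      unfolding V_def by (intro image_eqI[of _ _ "reverse_bond b"]) auto
  qed
  have hd: "hd bs \<in> set bs"
    using walk by (simp add: simple_walk_def)
  have "v \<in> V" for v
  proof -
    have "(origin G (hd bs), v) \<in> {(origin G b, terminus G b) | b. True}\<^sup>*"
      using conn unfolding connected_graph_def by simp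
    then show ?thesis
    proof (induction rule: rtrancl_induct)
      case base
      then show ?case
        using hd unfolding V_def by blast
    next
      case (step y z)
      then show ?case
        using \<open>\<And>b. origin G b \<in> V \<Longrightarrow> terminus G b \<in> V\<close> by blast
    qed
  qed
  then have "fst (e, True) \<in> ?K" for e
  proof -
    obtain b' where "fst b' \<in> ?K" "origin G (e, True) = origin G b'"
      using \<open>\<And>v. v \<in> V\<close>[of "origin G (e, True)"] unfolding V_def by blast
    then show ?thesis
      using neg by blast
  qed
  then show False
    using assms(3) by auto
qed

text \<open>Constancy of the vertex amplitude along K and its zero at an exit from K make it vanish
  on all of K. Then opposite bonds carry opposite waves, and the Kirchhoff rule hands the same
  amplitude from each edge to the next.\<close>

lemma walk_mode_unique:
  assumes conn: "connected_graph G" and walk: "simple_walk G bs" and proper: "fst ` set bs \<noteq> UNIV"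
    and w: "\<And>e. e \<in> fst ` set bs \<Longrightarrow> w $ e = walk_phase G e"
    and fixed: "bond_fixed G w a"
    and off: "\<And>b. fst b \<notin> fst ` set bs \<Longrightarrow> a $ b = 0 \<and> (bond_scattering G *v a) $ b = 0"
  shows "\<exists>c. a = c *s walk_mode G bs"
proof -
  let ?K = "fst ` set bs"
  \<comment> \<open>A Neumann end may have a nonzero amplitude; replacing it by 0 makes
    \<open>?c\<close> constant along paths as well as cycles.\<close>
  let ?c = "\<lambda>v. if exterior G v then 0 else vertex_amplitude G a v"
  have dist: "distinct (map fst bs)" and succ: "successively (\<lambda>b b'. terminus G b = origin G b') bs"
    and inj_o: "inj_on (origin G) (set bs)" and inj_t: "inj_on (terminus G) (set bs)"
    using walk by (auto simp: simple_walk_def distinct_map)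
  have a: "a $ b = end_phase G (origin G b) * end_phase G (terminus G b) * (bond_scattering G *v a) $ b"
    if "fst b \<in> ?K" for b
    using fixed w[OF that] unfolding bond_fixed_def by (metis walk_phase_bond)
  have S: "(bond_scattering G *v a) $ b =
      (if neumann_vertex G (origin G b) then a $ reverse_bond b
       else ?c (origin G b) - a $ reverse_bond b)" for b
  proof (cases "neumann_vertex G (origin G b)")
    case True
    then show ?thesis
      by (simp add: scattering_neumann)
  next
    case False
    then have "exterior G (origin G b) \<Longrightarrow> dirichlet_vertex G (origin G b)"
      by (cases "bc G (origin G b)") (auto simp: neumann_vertex_def dirichlet_vertex_def)
    then show ?thesis
      using False by (auto simp: scattering_nth vertex_amplitude_def)
  qed
  \<comment> \<open>A round trip to the exterior end returns the outgoing wave with sign -1: by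
    reflection -1 at edge phase 1, or by reflection +1 and the edge phase \<open>\<i>\<close> passed
    twice. Outgoing and incoming wave therefore cancel at the other vertex.\<close>
  have end_zero: "?c (terminus G b) = 0" if b: "fst b \<in> ?K" and ext: "exterior G (origin G b)" for b
  proof (cases "exterior G (terminus G b)")
    case False
    then have nn: "\<not> neumann_vertex G (terminus G b)"
      by (simp add: neumann_vertex_def)
    have 1: "a $ b = end_phase G (origin G b) * (bond_scattering G *v a) $ b"
      using a[OF b] nn by (simp add: end_phase_def)
    have 2: "a $ reverse_bond b = end_phase G (origin G b) * (?c (terminus G b) - a $ b)"
      using a[of "reverse_bond b"] b nn S[of "reverse_bond b"] by (simp add: end_phase_def)
    show ?thesis
    proof (cases "neumann_vertex G (origin G b)")
      case True
      then have "a $ reverse_bond b = \<i> * ?c (terminus G b) + a $ reverse_bond b"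
        using 1 2 S[of b] by (simp add: end_phase_def algebra_simps)
      then show ?thesis
        by simp
    next
      case False
      then show ?thesis
        using 1 2 S[of b] ext by (simp add: end_phase_def)
    qed
  qed simp
  have c_edge: "?c (origin G b) = ?c (terminus G b)" if b: "fst b \<in> ?K" for b
  proof (cases "exterior G (origin G b) \<or> exterior G (terminus G b)")
    case True
    then show ?thesis
      using end_zero[OF b] end_zero[of "reverse_bond b"] b by auto
  next
    case False
    \<comment> \<open>At edge phase 1 both vertex amplitudes equal
      \<open>a $ b + a $ reverse_bond b\<close>.\<close>
    then have "end_phase G (origin G b) = 1" "end_phase G (terminus G b) = 1"
      by (auto simp: end_phase_def neumann_vertex_def)
    then show ?thesis
      using a[OF b] a[of "reverse_bond b"] S[of b] S[of "reverse_bond b"] b False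
      by (simp add: neumann_vertex_def)
  qed
  have c_const: "?c (origin G b) = ?c (origin G (hd bs))" if "b \<in> set bs" for b
  proof (rule successively_constant[OF _ that])
    show "successively (\<lambda>b b'. ?c (origin G b) = ?c (origin G b')) bs"
    proof (rule successively_mono[OF succ])
      fix b b' assume "b \<in> set bs" "terminus G b = origin G b'"
      then show "?c (origin G b) = ?c (origin G b')"
        using c_edge[of b] by simp
    qed
  qed
  obtain b0 b1 where b01: "fst b0 \<notin> ?K" "fst b1 \<in> ?K" "origin G b0 = origin G b1"
    using walk_leaves_proper_subgraph[OF conn walk proper] by blast
  \<comment> \<open>The edge of \<open>b0\<close> neither sends a wave to this vertex nor receives
    one from it, and the two add up to the vertex amplitude.\<close>
  have "?c (origin G b1) = 0"
    using off[OF b01(1)] off[of "reverse_bond b0"] b01 by (auto simp: scattering_nth)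
  moreover have "?c (origin G b1) = ?c (origin G (hd bs))"
    using b01(2) c_const[of b1] c_const[of "reverse_bond b1"] c_edge[of b1]
    by (auto simp: in_walk_edges_iff)
  ultimately have c_zero: "?c (origin G b) = 0" "?c (terminus G b) = 0" if "b \<in> set bs" for b
    using c_const[OF that] c_edge[of b] that by auto
  \<comment> \<open>Normalised so that the mode itself has \<open>g b = 1\<close> along the
    walk.\<close>
  define g where "g = (\<lambda>b. a $ b / end_phase G (terminus G b))"
  have rev: "a $ reverse_bond b = - g b * end_phase G (origin G b)" if b: "b \<in> set bs" for b
  proof -
    have "a $ reverse_bond b = end_phase G (terminus G b) * end_phase G (origin G b)
        * (bond_scattering G *v a) $ reverse_bond b"
      using a[of "reverse_bond b"] b by simp
    then show ?thesis
      using S[of "reverse_bond b"] c_zero(2)[OF b] by (auto simp: g_def end_phase_def split: if_splits)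
  qed
  have g_step: "g b = g b'"
    if b: "b \<in> set bs" "b' \<in> set bs" "fst b \<noteq> fst b'" "terminus G b = origin G b'" for b b'
  proof -
    let ?v = "terminus G b"
    have ext: "\<not> exterior G ?v"
      using exterior_terminus_unique[of G ?v b "reverse_bond b'"] b(3,4) by auto
    then have eta: "end_phase G ?v = 1"
      by (simp add: end_phase_def neumann_vertex_def)
    \<comment> \<open>The walk enters \<open>?v\<close> only by \<open>b\<close> and leaves it only
      by \<open>b'\<close>, so all other incoming bonds lie off K.\<close>
    have "(\<Sum>b'' | terminus G b'' = ?v. a $ b'') = (\<Sum>b'' \<in> {b, reverse_bond b'}. a $ b'')"
    proof (rule sum.mono_neutral_right)
      show "\<forall>b''\<in>{b''. terminus G b'' = ?v} - {b, reverse_bond b'}. a $ b'' = 0"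
      proof
        fix b'' assume b'': "b'' \<in> {b''. terminus G b'' = ?v} - {b, reverse_bond b'}"
        have "b'' \<notin> set bs"
          using b'' b(1) inj_t by (auto dest: inj_onD)
        moreover have "reverse_bond b'' \<notin> set bs"
        proof
          assume "reverse_bond b'' \<in> set bs"
          moreover have "origin G (reverse_bond b'') = origin G b'"
            using b'' b(4) by simp
          ultimately have "reverse_bond b'' = b'"
            using inj_o b(2) by (metis inj_onD)
          then show False
            using b'' by auto
        qed
        ultimately show "a $ b'' = 0"
          using off by (simp add: in_walk_edges_iff)
      qed
    qed (use b(4) in auto)
    moreover have "vertex_amplitude G a ?v = 0"
      using c_zero(2)[OF b(1)] ext by simp
    moreover have "vdegree G ?v \<noteq> 0" "\<not> dirichlet_vertex G ?v"
      using vdegree_origin_pos[of G b'] b(4) ext by (simp_all add: dirichlet_vertex_def)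
    moreover have "b \<noteq> reverse_bond b'"
      using b(3) by auto
    ultimately have "a $ b + a $ reverse_bond b' = 0"
      by (simp add: vertex_amplitude_def del: distrib_left_numeral)
    then show ?thesis
      using rev[OF b(2)] eta b(4) by (simp add: g_def)
  qed
  have g_const: "g b = g (hd bs)" if "b \<in> set bs" for b
  proof (rule successively_constant[OF _ that])
    show "successively (\<lambda>b b'. g b = g b') bs"
      unfolding successively_conv_nth
    proof (intro allI impI)
      fix i assume i: "Suc i < length bs"
      have "fst (bs ! i) \<noteq> fst (bs ! Suc i)"
        using dist i by (simp add: distinct_conv_nth)
      then show "g (bs ! i) = g (bs ! Suc i)"
        using g_step i succ by (simp add: successively_conv_nth)
    qed
  qed
  have "a $ b = g (hd bs) * walk_mode G bs $ b" for b
  proof -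
    consider "b \<in> set bs" | "reverse_bond b \<in> set bs" | "fst b \<notin> ?K"
      using in_walk_edges_iff[of b bs] by blast
    then show ?thesis
    proof cases
      case 1
      then have "walk_flow bs b = 1"
        using walk_not_reverse[OF dist] by (simp add: walk_flow_def)
      moreover have "end_phase G (terminus G b) \<noteq> 0"
        by (simp add: end_phase_def)
      ultimately show ?thesis
        unfolding g_const[OF 1, symmetric] by (simp add: walk_mode_def g_def)
    next
      case 2
      then have "walk_flow bs b = - 1"
        using walk_not_reverse[OF dist 2] by (simp add: walk_flow_def)
      then show ?thesis
        using rev[OF 2] g_const[OF 2] by (simp add: walk_mode_def)
    next
      case 3
      then show ?thesis
        using off[OF 3] by (simp add: walk_mode_def walk_flow_def in_walk_edges_iff)
    qed
  qed
  then show ?thesis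
    by (intro exI[of _ "g (hd bs)"]) (simp add: vec_eq_iff)
qed


section \<open>Generic phases off the subgraph\<close>

lemma holomorphic_on_det:
  fixes A :: "complex \<Rightarrow> complex ^ 'n ^ 'n"
  assumes "\<And>i j. (\<lambda>z. A z $ i $ j) holomorphic_on S"
  shows "(\<lambda>z. det (A z)) holomorphic_on S"
  unfolding det_def by (intro holomorphic_intros assms)

text \<open>
  Adding the projection onto a fixed vector \<open>m\<close> to \<open>I - U\<close> makes the matrix regular iff the
  eigenvalue \<open>1\<close> is simple, so that simplicity becomes the nonvanishing of a polynomial.
\<close>

definition deflated_matrix ::
    "('v, 'e::finite) qgraph \<Rightarrow> complex ^ 'e \<Rightarrow> complex ^ 'e bond \<Rightarrow> complex ^ 'e bond ^ 'e bond" where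
  "deflated_matrix G w m = (\<chi> b b'. secular_matrix G w $ b $ b' + m $ b * cnj (m $ b'))"

lemma deflated_matrix_mult_nth:
  "(deflated_matrix G w m *v a) $ b
    = a $ b - w $ fst b * (bond_scattering G *v a) $ b + m $ b * (\<Sum>b'\<in>UNIV. cnj (m $ b') * a $ b')"
proof -
  have "(deflated_matrix G w m *v a) $ b
      = (secular_matrix G w *v a) $ b + m $ b * (\<Sum>b'\<in>UNIV. cnj (m $ b') * a $ b')"
    by (simp only: deflated_matrix_def matrix_vector_mult_def vec_lambda_beta distrib_right
        sum.distrib sum_distrib_left mult.assoc)
  then show ?thesis
    by (simp add: secular_matrix_mult_nth)
qed

lemma exists_generic_phase:
  fixes G :: "('v::finite, 'e::finite) qgraph"
  assumes conn: "connected_graph G" and walk: "simple_walk G bs" and proper: "fst ` set bs \<noteq> UNIV"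
  shows "\<exists>w. (\<forall>e. cmod (w $ e) = 1) \<and> bond_fixed G w (walk_mode G bs) \<and>
           (\<forall>a. bond_fixed G w a \<longrightarrow> (\<exists>c. a = c *s walk_mode G bs))"
proof -
  let ?K = "fst ` set bs" and ?m = "walk_mode G bs" and ?S = "bond_scattering G"
  let ?ip = "\<lambda>x y :: complex ^ 'e bond. \<Sum>b\<in>UNIV. cnj (x $ b) * y $ b"
  define w :: "complex \<Rightarrow> complex ^ 'e" where "w z = (\<chi> e. if e \<in> ?K then walk_phase G e else z)" for z
  have dist: "distinct (map fst bs)"
    using walk by (simp add: simple_walk_def)
  have fixed: "bond_fixed G (w z) ?m" for z
    by (rule bond_fixed_walk_mode[OF walk]) (simp add: w_def)
  have m_off: "?m $ b = 0" if "fst b \<notin> ?K" for b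
    using norm_walk_mode[OF dist, of G b] that by simp
  \<comment> \<open>Any nonzero z would do in place of 1: the phase can then be cancelled from the
    fixed-point equation.\<close>
  have Sm_off: "(?S *v ?m) $ b = 0" if "fst b \<notin> ?K" for b
    using fixed[of 1, unfolded bond_fixed_def, rule_format, of b] m_off[OF that] that by (simp add: w_def)
  have ip_pos: "?ip ?m ?m \<noteq> 0"
  proof -
    obtain b where "b \<in> set bs"
      using walk hd_in_set unfolding simple_walk_def by blast
    then have "?m $ b \<noteq> 0"
      using norm_walk_mode[OF dist, of G b] by auto
    then have "0 < (\<Sum>b\<in>UNIV. (cmod (?m $ b))\<^sup>2)"
      by (intro sum_pos2[of _ b]) auto
    moreover have "?ip ?m ?m = of_real (\<Sum>b\<in>UNIV. (cmod (?m $ b))\<^sup>2)"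
      by (simp only: of_real_sum complex_norm_square mult.commute)
    ultimately show ?thesis
      by (simp del: of_real_sum)
  qed
  define p where "p z = det (deflated_matrix G (w z) ?m)" for z
  have "(\<lambda>z. w z $ e) holomorphic_on UNIV" for e
    by (cases "e \<in> ?K") (simp_all add: w_def)
  then have hol: "p holomorphic_on UNIV"
    unfolding p_def deflated_matrix_def secular_matrix_def
    by (intro holomorphic_on_det) (simp, intro holomorphic_intros)
  have p0: "p 0 \<noteq> 0"
  proof
    assume "p 0 = 0"
    then obtain x where x: "x \<noteq> 0" "deflated_matrix G (w 0) ?m *v x = 0"
      unfolding p_def det_eq_0_iff_kernel by blast
    have eq: "x $ b - w 0 $ fst b * (?S *v x) $ b + ?m $ b * ?ip ?m x = 0" for b
      using x(2) deflated_matrix_mult_nth[of G "w 0" ?m x b] by simp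
    \<comment> \<open>This makes \<open>?m\<close> a left fixed vector, although \<open>w 0\<close>
      is not unimodular: off K both \<open>?m\<close> and its scattered wave vanish. By the isometry
      of scattering, pairing \<open>eq\<close> with \<open>?m\<close> leaves only the rank-one
      term.\<close>
    have adj: "cnj (?m $ b) * (w 0 $ fst b * (?S *v x) $ b) = cnj ((?S *v ?m) $ b) * (?S *v x) $ b" for b
    proof (cases "fst b \<in> ?K")
      case True
      have unit: "cnj (w 0 $ fst b) * w 0 $ fst b = 1"
        using True complex_norm_square[of "walk_phase G (fst b)"] by (simp add: w_def mult.commute)
      have "cnj (?m $ b) = cnj (w 0 $ fst b) * cnj ((?S *v ?m) $ b)"
        using arg_cong[OF fixed[of 0, unfolded bond_fixed_def, rule_format, of b], of cnj] by simp
      then show ?thesis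
        using unit by simp
    next
      case False
      then show ?thesis
        by (simp add: m_off Sm_off)
    qed
    have "0 = (\<Sum>b\<in>UNIV. cnj (?m $ b) * (x $ b - w 0 $ fst b * (?S *v x) $ b + ?m $ b * ?ip ?m x))"
      by (simp only: eq) simp
    also have "\<dots> = ?ip ?m x - (\<Sum>b\<in>UNIV. cnj (?m $ b) * (w 0 $ fst b * (?S *v x) $ b)) + ?ip ?m ?m * ?ip ?m x"
      by (simp only: ring_distribs sum.distrib sum_subtractf sum_distrib_right mult.assoc)
    also have "\<dots> = ?ip ?m ?m * ?ip ?m x"
      using scattering_isometry[of G ?m x] by (simp only: adj) simp
    finally have ip0: "?ip ?m x = 0"
      using ip_pos by simp
    then have fx: "bond_fixed G (w 0) x"
      using eq by (simp add: bond_fixed_def)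
    have "\<exists>c. x = c *s ?m"
    proof (rule walk_mode_unique[OF conn walk proper _ fx])
      fix b :: "'e bond" assume "fst b \<notin> ?K"
      then have w0: "w 0 $ fst b = 0"
        by (simp add: w_def)
      moreover have "cmod (w 0 $ e) \<le> 1" for e
        by (simp add: w_def)
      ultimately have "(?S *v x) $ b = 0"
        by (intro bond_fixed_contraction[OF fx]) auto
      then show "x $ b = 0 \<and> (?S *v x) $ b = 0"
        using fx[unfolded bond_fixed_def, rule_format, of b] by simp
    qed (simp add: w_def)
    then obtain c where c: "x = c *s ?m" ..
    have "?ip ?m x = c * ?ip ?m ?m"
      by (simp add: c sum_distrib_left mult_ac)
    then have "c = 0"
      using ip0 ip_pos by simp
    then show False
      using c x(1) by simp
  qed
  obtain z where z: "cmod z = 1" "p z \<noteq> 0"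
  proof (rule ccontr)
    assume "\<not> thesis"
    then have zero: "p z = 0" if "cmod z = 1" for z
      using that \<open>\<And>z. cmod z = 1 \<Longrightarrow> p z \<noteq> 0 \<Longrightarrow> thesis\<close> by blast
    \<comment> \<open>Maximum modulus on the unit disc: zero boundary values would reach the
      centre.\<close>
    have "cmod (p 0) \<le> 0"
    proof (rule maximum_modulus_frontier[of p "cball 0 1"])
      show "p holomorphic_on interior (cball 0 1)"
        using hol holomorphic_on_subset by blast
      show "continuous_on (closure (cball 0 1)) p"
        using hol holomorphic_on_imp_continuous_on holomorphic_on_subset by blast
    qed (use zero in auto)
    with p0 show False
      by simp
  qed
  have "\<exists>c. a = c *s ?m" if a: "bond_fixed G (w z) a" for a
  proof -
    \<comment> \<open>Removing the component along the mode puts the rest into the kernel of the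
      deflated matrix.\<close>
    define c where "c = ?ip ?m a / ?ip ?m ?m"
    define x where "x = a - c *s ?m"
    have "?ip ?m x = ?ip ?m a - c * ?ip ?m ?m"
      by (simp add: x_def right_diff_distrib sum_subtractf sum_distrib_left mult_ac)
    then have ip: "?ip ?m x = 0"
      using ip_pos by (simp add: c_def)
    have "bond_fixed G (w z) x"
      unfolding x_def using a fixed by (rule bond_fixed_diff_scale)
    then have "deflated_matrix G (w z) ?m *v x = 0"
      using ip by (simp add: vec_eq_iff deflated_matrix_mult_nth bond_fixed_def)
    then have "x = 0"
      using z(2) unfolding p_def det_eq_0_iff_kernel by blast
    then show ?thesis
      by (auto simp: x_def)
  qed
  then show ?thesis
    using fixed z(1) by (intro exI[of _ "w z"]) (auto simp: w_def)
qed


section \<open>The orbit of the length vector\<close>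

text \<open>The form in which Kronecker's theorem takes independence. A set of reals does not record
  repeated entries, hence the separate injectivity; two equal lengths would violate the relation
  with coefficients 1 and -1.\<close>

lemma rationally_independent_imp_independent:
  fixes len :: "real ^ 'e"
  assumes ri: "rationally_independent len"
  shows "inj (($) len)" and "module.independent (\<lambda>r. (*) (real_of_int r)) (range (($) len))"
proof -
  interpret Modules.module "(\<lambda>r. (*) (real_of_int r))"
    by (simp add: Modules.module.intro distrib_left mult.commute)
  show inj: "inj (($) len)"
  proof (rule injI, rule ccontr)
    fix e e' assume eq: "len $ e = len $ e'" and ne: "e \<noteq> e'"
    define m :: "int ^ 'e" where "m = (\<chi> i. of_bool (i = e) - of_bool (i = e'))"
    have "(\<Sum>i\<in>UNIV. of_int (m $ i) * len $ i) = 0"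
      using eq by (simp add: m_def left_diff_distrib sum_subtractf of_bool_def
          if_distrib[of of_int] if_distrib[of "\<lambda>x. x * _"] cong: if_cong)
    then have "m = 0"
      using ri unfolding rationally_independent_def by blast
    then have "m $ e = 0"
      by simp
    with ne show False
      by (simp add: m_def)
  qed
  show "independent (range (($) len))"
    unfolding dependent_explicit
  proof clarify
    fix t u v
    assume t: "finite t" "t \<subseteq> range (($) len)" "(\<Sum>v\<in>t. real_of_int (u v) * v) = 0"
      and v: "v \<in> t" "u v \<noteq> 0"
    define m :: "int ^ 'e" where "m = (\<chi> e. if len $ e \<in> t then u (len $ e) else 0)"
    have "(\<Sum>e\<in>UNIV. of_int (m $ e) * len $ e) = (\<Sum>e | len $ e \<in> t. of_int (u (len $ e)) * len $ e)"
      by (auto simp: m_def intro!: sum.mono_neutral_cong_right split: if_splits)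
    also have "\<dots> = (\<Sum>v\<in>t. of_int (u v) * v)"
      using t(2) inj by (intro sum.reindex_bij_betw) (auto simp: bij_betw_def inj_on_def)
    finally have "m = 0"
      using ri t(3) unfolding rationally_independent_def by simp
    obtain e where "v = len $ e"
      using v(1) t(2) by blast
    with v have "m $ e \<noteq> 0"
      by (simp add: m_def)
    with \<open>m = 0\<close> show False
      by simp
  qed
qed

lemma Kronecker_angles:
  fixes len :: "real ^ 'e"
  assumes ri: "rationally_independent len" and "\<epsilon> > 0"
  shows "\<exists>t h. \<forall>e. \<bar>t * len $ e - 2 * pi * of_int (h e) - \<alpha> e\<bar> < \<epsilon>"
proof -
  obtain f where f: "bij_betw f {..<CARD('e)} (UNIV :: 'e set)"
    using ex_bij_betw_nat_finite[of "UNIV :: 'e set"] by (auto simp: lessThan_atLeast0)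
  define \<theta> where "\<theta> i = len $ f i" for i
  have "\<theta> ` {..<CARD('e)} = range (($) len)"
    using f by (auto simp: \<theta>_def bij_betw_def image_iff) (metis UNIV_I imageE lessThan_iff)
  then have indep: "module.independent (\<lambda>r. (*) (real_of_int r)) (\<theta> ` {..<CARD('e)})"
    using rationally_independent_imp_independent(2)[OF ri] by simp
  have inj: "inj_on \<theta> {..<CARD('e)}"
    using f rationally_independent_imp_independent(1)[OF ri]
    by (auto simp: \<theta>_def bij_betw_def inj_on_def)
  \<comment> \<open>Kronecker's theorem counts in full turns, so target and tolerance are divided by
    2 pi.\<close>
  have "\<epsilon> / (2 * pi) > 0"
    using assms by simp
  then obtain t h where th: "\<And>i. i < CARD('e) \<Longrightarrow> \<bar>t * \<theta> i - of_int (h i) - \<alpha> (f i) / (2 * pi)\<bar> < \<epsilon> / (2 * pi)"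
    using Kronecker_thm_1[OF indep inj, where \<alpha> = "\<lambda>i. \<alpha> (f i) / (2 * pi)"] by metis
  define g where "g = inv_into {..<CARD('e)} f"
  have "\<bar>(2 * pi * t) * len $ e - 2 * pi * of_int (h (g e)) - \<alpha> e\<bar> < \<epsilon>" for e
  proof -
    have g: "g e < CARD('e)" "f (g e) = e"
      using f bij_betw_inv_into_right[OF f, of e] inv_into_into[of e f "{..<CARD('e)}"]
      by (auto simp: g_def bij_betw_def)
    have "\<bar>2 * pi * (t * len $ e - of_int (h (g e)) - \<alpha> e / (2 * pi))\<bar> < 2 * pi * (\<epsilon> / (2 * pi))"
      using th[OF g(1)] by (simp only: abs_mult \<theta>_def g(2)) (simp add: field_simps)
    then show ?thesis
      by (simp add: algebra_simps)
  qed
  then show ?thesis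
    by (intro exI[of _ "2 * pi * t"] exI[of _ "\<lambda>e. h (g e)"]) auto
qed

lemma tendsto_abs_angle:
  assumes "(f \<longlongrightarrow> l) F"
  shows "((\<lambda>x. abs_angle (f x)) \<longlongrightarrow> abs_angle l) F"
proof (rule topological_tendstoI)
  fix S assume "open S" "abs_angle l \<in> S"
  then have "open (abs_angle -` S)" "l \<in> abs_angle -` S"
    by (simp_all add: open_angle_def)
  then show "eventually (\<lambda>x. abs_angle (f x) \<in> S) F"
    using topological_tendstoD[OF assms, of "abs_angle -` S"] by simp
qed

text \<open>The type \<open>angle\<close> carries only its quotient topology, so the estimate is
  made for real representatives and pushed through the continuous quotient map, which ignores the
  multiples of 2 pi.\<close>

lemma orbit_closure_full:
  fixes len :: "real ^ 'e"
  assumes ri: "rationally_independent len"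
  shows "(\<chi> e. abs_angle (\<alpha> e)) \<in> orbit_closure len"
proof -
  have "\<forall>n. \<exists>t h. \<forall>e. \<bar>t * len $ e - 2 * pi * of_int (h e) - \<alpha> e\<bar> < 1 / real (Suc n)"
    using Kronecker_angles[OF ri] by simp
  then obtain t h where th: "\<And>n e. \<bar>t n * len $ e - 2 * pi * of_int (h n e) - \<alpha> e\<bar> < 1 / real (Suc n)"
    by metis
  have lim: "(\<lambda>n. abs_angle (t n * len $ e)) \<longlonglongrightarrow> abs_angle (\<alpha> e)" for e
  proof -
    have "(\<lambda>n. (t n * len $ e - 2 * pi * of_int (h n e)) - \<alpha> e) \<longlonglongrightarrow> 0"
      by (rule Lim_null_comparison[OF _ lim_inverse_n'[THEN LIMSEQ_Suc]])
        (use less_imp_le[OF th] in \<open>simp add: inverse_eq_divide\<close>)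
    then have "(\<lambda>n. abs_angle (t n * len $ e - 2 * pi * of_int (h n e))) \<longlonglongrightarrow> abs_angle (\<alpha> e)"
      by (intro tendsto_abs_angle) (simp add: LIM_zero_iff)
    moreover have "abs_angle (t n * len $ e - 2 * pi * of_int (h n e)) = abs_angle (t n * len $ e)" for n
      unfolding angle.abs_eq_iff angle_rel_def by (intro exI[of _ "- h n e"]) simp
    ultimately show ?thesis
      by simp
  qed
  show ?thesis
    unfolding orbit_closure_def
  proof (rule Lim_in_closed_set[OF closed_closure])
    show "(\<lambda>n. \<chi> e. abs_angle (t n * len $ e)) \<longlonglongrightarrow> (\<chi> e. abs_angle (\<alpha> e))"
      using lim by (intro vec_tendstoI) simp
    show "\<forall>\<^sub>F n in sequentially. (\<chi> e. abs_angle (t n * len $ e))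
        \<in> closure (range (\<lambda>k. \<chi> e. abs_angle (k * len $ e)))"
      by (intro always_eventually allI closure_subset[THEN subsetD] rangeI)
  qed simp
qed

section \<open>Late times at which the orbit is close to a given point\<close>

lemma norm_cis_diff_le: "cmod (cis x - cis y) \<le> \<bar>x - y\<bar>"
proof -
  have "cis x - cis y = cis y * (cis (x - y) - 1)"
    by (simp add: right_diff_distrib cis_mult)
  then have "cmod (cis x - cis y) = cmod (exp (\<i> * of_real (x - y)) - 1)"
    by (simp add: norm_mult cis_conv_exp)
  also have "\<dots> = 2 * \<bar>sin ((x - y) / 2)\<bar>"
    by (rule dist_exp_i_1)
  also have "\<dots> \<le> \<bar>x - y\<bar>"
    using abs_sin_x_le_abs_x[of "(x - y) / 2"] by simp
  finally show ?thesis .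
qed

lemma norm_vec_le_sum: "norm x \<le> (\<Sum>i\<in>UNIV. norm (x $ i))"
  by (simp add: norm_vec_def L2_set_le_sum)

text \<open>By compactness the phases at integer times have a Cauchy subsequence; the difference of
  two late times of it is a near return.\<close>

lemma phase_recurrence:
  fixes len :: "real ^ 'e"
  assumes "\<epsilon> > 0"
  shows "\<exists>T\<ge>N. \<forall>e. cmod (cis (T * len $ e) - 1) < \<epsilon>"
proof -
  define x :: "nat \<Rightarrow> complex ^ 'e" where "x n = (\<chi> e. cis (real n * len $ e))" for n
  have "norm (x n) \<le> real CARD('e)" for n
    using norm_vec_le_sum[of "x n"] by (simp add: x_def)
  then have "bounded (range x)"
    by (auto simp: bounded_iff)
  then obtain l r where r: "strict_mono r" "(x \<circ> r) \<longlonglongrightarrow> l"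
    using bounded_imp_convergent_subsequence by blast
  then have "Cauchy (x \<circ> r)"
    using LIMSEQ_imp_Cauchy by blast
  then obtain M where M: "\<And>m n. m \<ge> M \<Longrightarrow> n \<ge> M \<Longrightarrow> dist ((x \<circ> r) m) ((x \<circ> r) n) < \<epsilon>"
    unfolding Cauchy_def using assms by blast
  \<comment> \<open>Since \<open>r n \<ge> n\<close>, the summand \<open>r M\<close> pays for the
    time that is subtracted.\<close>
  define n where "n = M + (r M + nat \<lceil>N\<rceil>)"
  have "real (r n) \<ge> real n"
    using seq_suble[OF r(1), of n] by simp
  then have "real (r n) - real (r M) \<ge> N"
    unfolding n_def using real_nat_ceiling_ge[of N] by simp
  moreover have "cmod (cis ((real (r n) - real (r M)) * len $ e) - 1) < \<epsilon>" for e
  proof -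
    have "cis (real (r n) * len $ e) - cis (real (r M) * len $ e)
        = cis (real (r M) * len $ e) * (cis ((real (r n) - real (r M)) * len $ e) - 1)"
      by (simp add: right_diff_distrib left_diff_distrib cis_mult)
    then have "cmod (cis ((real (r n) - real (r M)) * len $ e) - 1) = cmod ((x (r n) - x (r M)) $ e)"
      by (simp add: x_def norm_mult)
    also have "\<dots> \<le> dist (x (r n)) (x (r M))"
      unfolding dist_norm by (rule Finite_Cartesian_Product.norm_nth_le)
    also have "\<dots> < \<epsilon>"
      using M[of n M] by (simp add: n_def)
    finally show ?thesis .
  qed
  ultimately show ?thesis
    by blast
qed

text \<open>Half of the tolerance goes to a Kronecker time \<open>t\<close>, the other half to a
  return time of at least \<open>N - t\<close>.\<close>

lemma orbit_approx_unbounded: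
  fixes len :: "real ^ 'e"
  assumes ri: "rationally_independent len" and w: "\<And>e. cmod (w e) = 1" and "\<epsilon> > 0"
  shows "\<exists>k\<ge>N. \<forall>e. cmod (cis (k * len $ e) - w e) < \<epsilon>"
proof -
  have e2: "\<epsilon> / 2 > 0"
    using assms by simp
  obtain t h where th: "\<And>e. \<bar>t * len $ e - 2 * pi * of_int (h e) - Arg (w e)\<bar> < \<epsilon> / 2"
    using Kronecker_angles[OF ri e2, of "\<lambda>e. Arg (w e)"] by blast
  obtain T where T: "T \<ge> N - t" "\<And>e. cmod (cis (T * len $ e) - 1) < \<epsilon> / 2"
    using phase_recurrence[OF e2] by blast
  have "cmod (cis ((t + T) * len $ e) - w e) < \<epsilon>" for e
  proof -
    have "cis (t * len $ e) = cis ((t * len $ e - 2 * pi * of_int (h e)) + 2 * pi * of_int (h e))"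
      by simp
    also have "\<dots> = cis (t * len $ e - 2 * pi * of_int (h e))"
      by (simp only: cis_mult[symmetric] cis_multiple_2pi[OF Ints_of_int] mult_1_right)
    finally have t: "cis (t * len $ e) = cis (t * len $ e - 2 * pi * of_int (h e))" .
    have "w e = cis (Arg (w e))"
      using w[of e] cis_Arg[of "w e"] by (cases "w e = 0") (auto simp: sgn_div_norm)
    then have 1: "cmod (cis (t * len $ e) - w e) < \<epsilon> / 2"
      using norm_cis_diff_le[of "t * len $ e - 2 * pi * of_int (h e)" "Arg (w e)"] th[of e] by (simp add: t)
    have "cis ((t + T) * len $ e) - w e = cis (t * len $ e) * (cis (T * len $ e) - 1) + (cis (t * len $ e) - w e)"
      by (simp add: algebra_simps cis_mult)
    also have "cmod \<dots> \<le> cmod (cis (T * len $ e) - 1) + cmod (cis (t * len $ e) - w e)"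
      using norm_triangle_ineq by (metis (no_types, lifting) mult_1 norm_cis norm_mult)
    finally show ?thesis
      using 1 T(2)[of e] by simp
  qed
  moreover have "t + T \<ge> N"
    using T(1) by simp
  ultimately show ?thesis
    by blast
qed


section \<open>Eigenvalues near a zero of the secular determinant\<close>

lemma secular_zero_real:
  fixes G :: "('v::finite, 'e::finite) qgraph"
  assumes len: "\<And>e. len $ e > 0" and \<omega>: "\<And>e. cmod (\<omega> $ e) = 1"
    and zero: "det (secular_matrix G (\<chi> e. \<omega> $ e * exp (\<i> * s * of_real (len $ e)))) = 0"
  shows "Im s = 0"
proof (rule ccontr)
  assume "Im s \<noteq> 0"
  let ?w = "(\<chi> e. \<omega> $ e * exp (\<i> * s * of_real (len $ e))) :: complex ^ 'e"
  obtain a where a: "a \<noteq> 0" "bond_fixed G ?w a"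
    using zero det_secular_matrix_eq_0_iff by blast
  have norm: "cmod (?w $ e) = exp (- (Im s * len $ e))" for e
    by (simp add: norm_mult \<omega>)
  consider "Im s > 0" | "Im s < 0"
    using \<open>Im s \<noteq> 0\<close> by linarith
  then show False
  proof cases
    case 1
    then have lt: "cmod (?w $ e) < 1" for e
      using len[of e] unfolding norm by simp
    then have "(bond_scattering G *v a) $ b = 0" for b
      using bond_fixed_contraction[OF a(2), of b] less_imp_le by blast
    then have "a = 0"
      using a(2) by (simp add: bond_fixed_def vec_eq_iff)
    with a(1) show False ..
  next
    case 2
    then have "cmod (?w $ e) > 1" for e
      using len[of e] unfolding norm by (simp add: mult_neg_pos)
    then show False
      using bond_fixed_expansion[OF a(2)] a(1) by blast
  qed
qed

lemma continuous_on_det: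
  fixes A :: "'a::topological_space \<Rightarrow> complex ^ 'n ^ 'n"
  assumes "\<And>i j. continuous_on S (\<lambda>z. A z $ i $ j)"
  shows "continuous_on S (\<lambda>z. det (A z))"
  unfolding det_def by (intro continuous_intros assms)

text \<open>Were all functions along \<open>\<omega>\<close> zero-free on a disc about 0, their
  limit would be zero-free or constant, against its zero at 0. Since complex zeros of the
  determinant are real, the zero found is a true shift of the frequency.\<close>

lemma secular_zero_nearby:
  fixes G :: "('v::finite, 'e::finite) qgraph" and \<omega> :: "nat \<Rightarrow> complex ^ 'e"
  assumes len: "\<And>e. len $ e > 0" and w: "\<And>e. cmod (w $ e) = 1"
    and zero: "det (secular_matrix G w) = 0"
    and \<omega>: "\<And>n e. cmod (\<omega> n $ e) = 1" and lim: "\<omega> \<longlonglongrightarrow> w" and "\<delta> > 0"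
  shows "\<exists>n s. \<bar>s\<bar> < \<delta> \<and> det (secular_matrix G (\<chi> e. \<omega> n $ e * cis (s * len $ e))) = 0"
proof (rule ccontr)
  assume neg: "\<not> ?thesis"
  define F where "F = (\<lambda>(\<eta> :: complex ^ 'e, s).
    det (secular_matrix G (\<chi> e. \<eta> $ e * exp (\<i> * s * of_real (len $ e)))))"
  have cont: "continuous_on X F" for X
    unfolding F_def case_prod_unfold secular_matrix_def
    by (intro continuous_on_det) (simp, intro continuous_intros)
  have hol: "(\<lambda>s. F (\<eta>, s)) holomorphic_on X" for \<eta> X
    unfolding F_def case_prod_unfold secular_matrix_def
    by (intro holomorphic_on_det) (simp, intro holomorphic_intros)
  have im0: "Im s = 0" if "F (\<eta>, s) = 0" "\<And>e. cmod (\<eta> $ e) = 1" for \<eta> s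
    using secular_zero_real[of len \<eta> G s] len that by (simp add: F_def)
  let ?S = "ball (0 :: complex) \<delta>"
  have F0: "F (w, 0) = 0"
    using zero by (simp add: F_def)
  have "F (w, 0) \<noteq> 0"
  proof (rule Hurwitz_no_zeros[of ?S "\<lambda>n s. F (\<omega> n, s)" "\<lambda>s. F (w, s)" 0])
    show "uniform_limit X (\<lambda>n s. F (\<omega> n, s)) (\<lambda>s. F (w, s)) sequentially" if X: "compact X" for X
    proof (rule uniform_limitI)
      fix \<epsilon> :: real assume "\<epsilon> > 0"
      \<comment> \<open>Unimodular entries bound the norm by the number of edges, so one compact set
        contains all arguments and uniform continuity applies.\<close>
      let ?C = "cball (0 :: complex ^ 'e) (real CARD('e)) \<times> X"
      have "uniformly_continuous_on ?C F"
        using cont X by (intro compact_uniformly_continuous compact_Times) auto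
      then obtain d where d: "d > 0" "\<And>x y. x \<in> ?C \<Longrightarrow> y \<in> ?C \<Longrightarrow> dist y x < d \<Longrightarrow> dist (F y) (F x) < \<epsilon>"
        unfolding uniformly_continuous_on_def using \<open>\<epsilon> > 0\<close> by metis
      have in_C: "\<omega> n \<in> cball 0 (real CARD('e))" "w \<in> cball 0 (real CARD('e))" for n
        using norm_vec_le_sum[of "\<omega> n"] norm_vec_le_sum[of w] by (simp_all add: \<omega> w)
      have "\<forall>\<^sub>F n in sequentially. dist (\<omega> n) w < d"
        using lim d(1) by (rule tendstoD)
      then show "\<forall>\<^sub>F n in sequentially. \<forall>s\<in>X. dist (F (\<omega> n, s)) (F (w, s)) < \<epsilon>"
      proof eventually_elim
        case (elim n)
        then show ?case
          using in_C by (intro ballI d(2)) (auto simp: dist_Pair_Pair)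
      qed
    qed
    \<comment> \<open>A constant function would carry the zero at 0 to a point off the real
      axis.\<close>
    show "\<not> (\<lambda>s. F (w, s)) constant_on ?S"
    proof
      assume "(\<lambda>s. F (w, s)) constant_on ?S"
      then have "F (w, \<i> * of_real (\<delta> / 2)) = F (w, 0)"
        using \<open>\<delta> > 0\<close> unfolding constant_on_def by (auto simp: norm_mult)
      then have "Im (\<i> * of_real (\<delta> / 2)) = 0"
        using im0 F0 w by metis
      with \<open>\<delta> > 0\<close> show False
        by simp
    qed
    show "F (\<omega> n, s) \<noteq> 0" if s: "s \<in> ?S" for n s
    proof
      assume F: "F (\<omega> n, s) = 0"
      then have "s = of_real (Re s)"
        using im0 \<omega> by (simp add: complex_eq_iff)
      moreover from this have "exp (\<i> * s * of_real (len $ e)) = cis (Re s * len $ e)" for e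
        by (metis cis_conv_exp mult.assoc of_real_mult)
      ultimately have "det (secular_matrix G (\<chi> e. \<omega> n $ e * cis (Re s * len $ e))) = 0"
        using F by (simp add: F_def)
      moreover have "\<bar>Re s\<bar> < \<delta>"
        using s abs_Re_le_cmod[of s] by simp
      ultimately show False
        using neg by blast
    qed
  qed (use hol \<open>\<delta> > 0\<close> in auto)
  with F0 show False
    by simp
qed

lemma norm_of_real_vector_scale: "norm (complex_of_real r *s x) = \<bar>r\<bar> * norm x"
proof -
  have "complex_of_real r *s x = r *\<^sub>R x"
    by (simp add: vec_eq_iff) (simp add: scaleR_conv_of_real)
  then show ?thesis
    by simp
qed

lemma orbit_hits_secular_set:
  fixes G :: "('v::finite, 'e::finite) qgraph"
  assumes ri: "rationally_independent len" and len: "\<And>e. len $ e > 0"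
    and w: "\<And>e. cmod (w $ e) = 1" and a0: "bond_fixed G w a0" "a0 \<noteq> 0" and "\<epsilon> > 0"
  shows "\<exists>k a. k \<ge> N \<and> norm a = 1 \<and> bond_fixed G (\<chi> e. cis (k * len $ e)) a \<and>
           (\<forall>e. cmod (cis (k * len $ e) - w $ e) < \<epsilon>)"
proof -
  define L where "L = (\<Sum>e\<in>UNIV. len $ e)"
  have len_le: "len $ e \<le> L" for e
    unfolding L_def using len by (intro member_le_sum) (auto simp: less_imp_le)
  have "L > 0"
    unfolding L_def using len by (intro sum_pos) auto
  \<comment> \<open>The bound 1 is paid for by asking for \<open>N + 1\<close> below; the other
    bound limits the phase change on every edge to half of the tolerance.\<close>
  define \<delta> where "\<delta> = min 1 (\<epsilon> / (2 * L))"
  have \<delta>: "\<delta> > 0" "\<delta> \<le> 1" "\<delta> * L \<le> \<epsilon> / 2"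
    using \<open>\<epsilon> > 0\<close> \<open>L > 0\<close> by (auto simp: \<delta>_def min_def field_simps)
  have "\<exists>k\<ge>N + 1. \<forall>e. cmod (cis (k * len $ e) - w $ e) < min (\<epsilon> / 2) (1 / real (Suc n))" for n
    using w \<open>\<epsilon> > 0\<close> by (intro orbit_approx_unbounded[OF ri]) simp_all
  then obtain k where k: "\<And>n. k n \<ge> N + 1"
      "\<And>n e. cmod (cis (k n * len $ e) - w $ e) < min (\<epsilon> / 2) (1 / real (Suc n))"
    by metis
  have lim: "(\<lambda>n. \<chi> e. cis (k n * len $ e)) \<longlonglongrightarrow> w"
  proof (rule vec_tendstoI)
    fix e
    have "(\<lambda>n. cis (k n * len $ e) - w $ e) \<longlonglongrightarrow> 0"
    proof (rule Lim_null_comparison[OF _ lim_inverse_n'[THEN LIMSEQ_Suc]])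
      show "\<forall>\<^sub>F n in sequentially. cmod (cis (k n * len $ e) - w $ e) \<le> 1 / real (Suc n)"
        using k(2)[of _ e] by (intro always_eventually allI) (simp add: less_imp_le)
    qed
    then show "(\<lambda>n. (\<chi> e. cis (k n * len $ e)) $ e) \<longlonglongrightarrow> w $ e"
      by (simp add: LIM_zero_iff)
  qed
  have "det (secular_matrix G w) = 0"
    using a0 det_secular_matrix_eq_0_iff by blast
  then obtain n s where s: "\<bar>s\<bar> < \<delta>"
      "det (secular_matrix G (\<chi> e. (\<chi> e. cis (k n * len $ e)) $ e * cis (s * len $ e))) = 0"
    using secular_zero_nearby[of len w G "\<lambda>n. \<chi> e. cis (k n * len $ e)" \<delta>] len w lim \<delta>(1) by auto
  define k' where "k' = k n + s"
  have "(\<chi> e. (\<chi> e. cis (k n * len $ e)) $ e * cis (s * len $ e)) = (\<chi> e. cis (k' * len $ e))"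
    by (simp add: k'_def cis_mult distrib_right)
  then obtain a where a: "a \<noteq> 0" "bond_fixed G (\<chi> e. cis (k' * len $ e)) a"
    using s(2) det_secular_matrix_eq_0_iff by metis
  have "norm (complex_of_real (1 / norm a) *s a) = 1"
    unfolding norm_of_real_vector_scale using a(1) by simp
  moreover have "bond_fixed G (\<chi> e. cis (k' * len $ e)) (complex_of_real (1 / norm a) *s a)"
    using a(2) by (rule bond_fixed_scale)
  moreover have "k' \<ge> N"
    using k(1)[of n] s(1) \<delta>(2) by (simp add: k'_def)
  moreover have "cmod (cis (k' * len $ e) - w $ e) < \<epsilon>" for e
  proof -
    have "\<bar>s * len $ e\<bar> = \<bar>s\<bar> * len $ e"
      using len[of e] by (simp add: abs_mult)
    also have "\<dots> < \<delta> * len $ e"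
      using s(1) len[of e] by (rule mult_strict_right_mono)
    also have "\<dots> \<le> \<delta> * L"
      using len_le[of e] \<delta>(1) by simp
    finally have "\<bar>s * len $ e\<bar> < \<delta> * L" .
    moreover have "cmod (cis (k' * len $ e) - cis (k n * len $ e)) \<le> \<bar>s * len $ e\<bar>"
      using norm_cis_diff_le[of "k' * len $ e" "k n * len $ e"] by (simp add: k'_def algebra_simps)
    moreover have "cmod (cis (k n * len $ e) - w $ e) < \<epsilon> / 2"
      using k(2)[of n e] by simp
    ultimately show ?thesis
      using norm_triangle_ineq[of "cis (k' * len $ e) - cis (k n * len $ e)" "cis (k n * len $ e) - w $ e"] \<delta>(3)
      by simp
  qed
  ultimately show ?thesis
    by blast
qed


section \<open>Eigenfunctions\<close>

text \<open>Amplitudes are those on arrival: the wave of \<open>(e, True)\<close> has phase 0 at the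
  head, that of \<open>(e, False)\<close> at the tail. This fits \<open>bond_fixed\<close>, where
  the edge phase is applied after scattering.\<close>

definition bond_wave :: "real ^ 'e::finite \<Rightarrow> real \<Rightarrow> complex ^ 'e bond \<Rightarrow> 'e \<Rightarrow> real \<Rightarrow> complex" where
  "bond_wave len k a e x =
     a $ (e, True) * cis (k * (x - len $ e)) + a $ (e, False) * cis (- (k * x))"

definition bond_wave_deriv :: "real ^ 'e::finite \<Rightarrow> real \<Rightarrow> complex ^ 'e bond \<Rightarrow> 'e \<Rightarrow> real \<Rightarrow> complex" where
  "bond_wave_deriv len k a e x =
     \<i> * of_real k * (a $ (e, True) * cis (k * (x - len $ e)) - a $ (e, False) * cis (- (k * x)))"

lemma has_vector_derivative_cis_linear:
  "((\<lambda>x. cis (c * x + d)) has_vector_derivative \<i> * of_real c * cis (c * x + d)) (at x within S)"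
  unfolding has_vector_derivative_complex_iff
  by (auto intro!: derivative_eq_intros)

lemma bond_wave_has_deriv:
  "(bond_wave len k a e has_vector_derivative bond_wave_deriv len k a e x) (at x within S)"
proof -
  have *: "bond_wave len k a e =
      (\<lambda>x. a $ (e, True) * cis (k * x + - (k * len $ e)) + a $ (e, False) * cis (- k * x + 0))"
    by (auto simp: bond_wave_def algebra_simps)
  show ?thesis
    unfolding *
    by (rule derivative_eq_intros has_vector_derivative_cis_linear refl)+
      (simp add: bond_wave_deriv_def algebra_simps)
qed

lemma bond_wave_deriv_has_deriv:
  "(bond_wave_deriv len k a e has_vector_derivative - (of_real (k\<^sup>2) * bond_wave len k a e x)) (at x within S)"
proof -
  have *: "bond_wave_deriv len k a e =
      (\<lambda>x. \<i> * of_real k * (a $ (e, True) * cis (k * x + - (k * len $ e)) - a $ (e, False) * cis (- k * x + 0)))"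
    by (auto simp: bond_wave_deriv_def algebra_simps)
  show ?thesis
    unfolding *
    by (rule derivative_eq_intros has_vector_derivative_cis_linear refl)+
      (simp add: bond_wave_def algebra_simps power2_eq_square)
qed

lemma continuous_on_bond_wave: "continuous_on S (bond_wave len k a e)"
  by (rule continuous_on_vector_derivative) (rule bond_wave_has_deriv)

lemma set_lebesgue_integral_continuous:
  fixes f :: "real \<Rightarrow> 'a::euclidean_space"
  assumes "continuous_on {a..b} f"
  shows "(LINT x:{a..b}|lborel. f x) = integral {a..b} f"
  by (intro set_borel_integral_eq_integral borel_integrable_atLeastAtMost' assms)

lemma set_lebesgue_integral_FTC:
  fixes f :: "real \<Rightarrow> 'a::euclidean_space"
  assumes "a \<le> b" "\<And>x. x \<in> {a..b} \<Longrightarrow> (f has_vector_derivative f' x) (at x within {a..b})"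
    and "continuous_on {a..b} f'"
  shows "(LINT x:{a..b}|lborel. f' x) = f b - f a"
  using fundamental_theorem_of_calculus[OF assms(1,2)]
  by (simp add: set_lebesgue_integral_continuous[OF assms(3)] integral_unique)

lemma H2_onI:
  assumes f: "\<And>x S. (f has_vector_derivative f' x) (at x within S)"
    and f': "\<And>x S. (f' has_vector_derivative f'' x) (at x within S)"
    and cont: "\<And>S. continuous_on S f''"
  shows "H2_on L f f' f''"
proof -
  have cont': "continuous_on S f'" for S
    by (rule continuous_on_vector_derivative) (rule f')
  have "set_borel_measurable lborel {0..L} f''"
    using borel_integrable_atLeastAtMost'[OF cont] unfolding set_integrable_def set_borel_measurable_def
    by auto
  moreover have "set_integrable lborel {0..L} (\<lambda>x. (cmod (f'' x))\<^sup>2)"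
    by (intro borel_integrable_atLeastAtMost' continuous_intros cont)
  moreover have "(LINT t:{0..x}|lborel. f'' t) = f' x - f' 0" if "x \<in> {0..L}" for x
    using that by (intro set_lebesgue_integral_FTC f' cont) auto
  moreover have "(LINT t:{0..x}|lborel. f' t) = f x - f 0" if "x \<in> {0..L}" for x
    using that by (intro set_lebesgue_integral_FTC f cont') auto
  ultimately show ?thesis
    by (simp add: H2_on_def)
qed

section \<open>Waves of fixed vectors are eigenfunctions\<close>

context
  fixes G :: "('v, 'e::finite) qgraph" and len :: "real ^ 'e" and k :: real and a :: "complex ^ 'e bond"
  assumes fixed: "bond_fixed G (\<chi> e. cis (k * len $ e)) a"
begin

text \<open>Undoing the passage of the edge gives the amplitude with which the wave leaves its
  origin.\<close>

lemma bond_fixed_unwind: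
  "a $ b * cis (- (k * len $ fst b)) = vertex_amplitude G a (origin G b) - a $ reverse_bond b"
proof -
  have "a $ b = cis (k * len $ fst b) * (vertex_amplitude G a (origin G b) - a $ reverse_bond b)"
    using fixed[unfolded bond_fixed_def, rule_format, of b] by (simp add: scattering_nth)
  then have "a $ b * cis (- (k * len $ fst b)) =
      (cis (k * len $ fst b) * cis (- (k * len $ fst b))) * (vertex_amplitude G a (origin G b) - a $ reverse_bond b)"
    by simp
  then show ?thesis
    by (simp only: cis_mult) simp
qed

lemma bond_value_wave: "bond_value len (bond_wave len k a) b = vertex_amplitude G a (origin G b)"
  using bond_fixed_unwind[of b]
  by (cases b; cases "snd b") (simp_all add: bond_value_def bond_wave_def reverse_bond_def)

lemma bond_derivative_wave:
  "bond_derivative len (bond_wave_deriv len k a) b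
    = \<i> * of_real k * (vertex_amplitude G a (origin G b) - 2 * a $ reverse_bond b)"
proof -
  have "bond_derivative len (bond_wave_deriv len k a) b
    = \<i> * of_real k * (a $ b * cis (- (k * len $ fst b)) - a $ reverse_bond b)"
    by (cases b; cases "snd b")
      (simp_all add: bond_derivative_def bond_wave_deriv_def reverse_bond_def algebra_simps)
  then show ?thesis
    by (simp add: bond_fixed_unwind)
qed

lemma vertex_condition_wave:
  "vertex_condition G len (bond_wave len k a) (bond_wave_deriv len k a) v"
proof (cases "exterior G v")
  case True
  show ?thesis
  proof (cases "bc G v")
    case Dirichlet
    with True have "dirichlet_vertex G v"
      by (simp add: dirichlet_vertex_def)
    with True Dirichlet show ?thesis
      by (auto simp: vertex_condition_def bond_value_wave vertex_amplitude_def)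
  next
    case Neumann
    with True have "neumann_vertex G v"
      by (simp add: neumann_vertex_def)
    then have "vertex_amplitude G a v = 2 * a $ reverse_bond b" if "origin G b = v" for b
      using scattering_neumann[of G b a] that by (simp add: scattering_nth eq_diff_eq)
    with True Neumann show ?thesis
      by (auto simp: vertex_condition_def bond_derivative_wave)
  qed
next
  case False
  let ?c = "vertex_amplitude G a v" and ?d = "of_nat (vdegree G v) :: complex"
  have "(\<Sum>b | origin G b = v. bond_derivative len (bond_wave_deriv len k a) b)
      = (\<Sum>b | origin G b = v. \<i> * of_real k * (?c - 2 * a $ reverse_bond b))"
    by (intro sum.cong) (auto simp: bond_derivative_wave)
  also have "\<dots> = \<i> * of_real k * (?d * ?c - 2 * (\<Sum>b | terminus G b = v. a $ b))"
    by (simp add: sum_subtractf card_origin flip: sum_distrib_left sum_origin_reverse)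
  also have "\<dots> = 0"
  \<comment> \<open>At an isolated vertex the quotient in \<open>vertex_amplitude\<close> has
    denominator 0, but both terms vanish.\<close>
  proof (cases "vdegree G v = 0")
    case True
    then have "{b. terminus G b = v} = {}"
      by (simp add: card_eq_0_iff flip: card_terminus)
    then show ?thesis
      by (simp only: True sum.empty) simp
  next
    case deg: False
    then show ?thesis
      using False by (simp add: vertex_amplitude_def dirichlet_vertex_def)
  qed
  finally show ?thesis
    using False by (auto simp: vertex_condition_def continuous_at_vertex_def bond_value_wave)
qed

lemma neg_laplacian_wave:
  "neg_laplacian G len (bond_wave len k a) (\<lambda>e x. of_real (k\<^sup>2) * bond_wave len k a e x)"
  unfolding neg_laplacian_def
proof (intro exI conjI allI)
  fix e
  show "H2_on (len $ e) (bond_wave len k a e) (bond_wave_deriv len k a e)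
      ((\<lambda>e x. - (of_real (k\<^sup>2) * bond_wave len k a e x)) e)"
    by (intro H2_onI bond_wave_has_deriv bond_wave_deriv_has_deriv)
      (intro continuous_intros continuous_on_bond_wave)
qed (auto intro: vertex_condition_wave)

end


section \<open>High-frequency limits\<close>

text \<open>A merely continuous \<open>f\<close> cannot be integrated by parts, but a polynomial
  uniformly close to it can, and this gains a factor 1/k.\<close>

lemma Riemann_Lebesgue_cis:
  fixes f :: "real \<Rightarrow> complex"
  assumes f: "continuous_on {0..L} f" and "L \<ge> 0" and k: "filterlim k at_top sequentially"
  shows "(\<lambda>n. LINT x:{0..L}|lborel. f x * cis (k n * x)) \<longlonglongrightarrow> 0"
proof (rule tendstoI)
  fix \<epsilon> :: real assume "\<epsilon> > 0"
  \<comment> \<open>\<open>L + 1\<close> in place of \<open>L\<close> also covers an interval of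
    length 0.\<close>
  define \<eta> where "\<eta> = \<epsilon> / (2 * (L + 1))"
  have \<eta>: "\<eta> > 0" "\<eta> * L \<le> \<epsilon> / 2"
    using \<open>\<epsilon> > 0\<close> \<open>L \<ge> 0\<close> by (auto simp: \<eta>_def field_simps)
  obtain p where p: "polynomial_function p" "\<And>x. x \<in> {0..L} \<Longrightarrow> norm (f x - p x) < \<eta>"
    using Stone_Weierstrass_polynomial_function[OF compact_Icc f \<eta>(1)] by blast
  obtain p' where p': "polynomial_function p'" "\<And>x. (p has_vector_derivative p' x) (at x)"
    using has_vector_derivative_polynomial_function[OF p(1)] by blast
  have cont: "continuous_on S p" "continuous_on S p'" for S
    using p(1) p'(1) continuous_on_polymonial_function by blast+
  have "bounded (p ` {0..L} \<union> p' ` {0..L})"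
    using cont by (simp add: compact_imp_bounded compact_continuous_image)
  then obtain B where B: "\<And>x. x \<in> {0..L} \<Longrightarrow> norm (p x) \<le> B" "\<And>x. x \<in> {0..L} \<Longrightarrow> norm (p' x) \<le> B"
    unfolding bounded_iff by blast
  have "B \<ge> 0"
    using B(1)[of 0] \<open>L \<ge> 0\<close> norm_ge_zero[of "p 0"] by (meson atLeastAtMost_iff order_refl order_trans)
  \<comment> \<open>Two boundary terms and the integral of the derivative over length
    \<open>L\<close>.\<close>
  define C where "C = B * (2 + L)"
  have bound: "norm (LINT x:{0..L}|lborel. f x * cis (\<kappa> * x)) \<le> \<epsilon> / 2 + C / \<kappa>" if "\<kappa> > 0" for \<kappa>
  proof -
    have cc: "continuous_on S (\<lambda>x. cis (\<kappa> * x))" for S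
      by (intro continuous_intros)
    define F where "F x = p x * (cis (\<kappa> * x) / (\<i> * of_real \<kappa>))" for x
    define R where "R x = p' x * (cis (\<kappa> * x) / (\<i> * of_real \<kappa>))" for x
    have contR: "continuous_on {0..L} R"
      unfolding R_def by (intro continuous_intros cont cc) (use that in auto)
    have "(F has_vector_derivative R x + p x * cis (\<kappa> * x)) (at x within {0..L})" for x
    proof -
      have "((\<lambda>x. cis (\<kappa> * x + 0) / (\<i> * of_real \<kappa>)) has_vector_derivative
          \<i> * of_real \<kappa> * cis (\<kappa> * x + 0) / (\<i> * of_real \<kappa>)) (at x within {0..L})"
        by (intro has_vector_derivative_divide has_vector_derivative_cis_linear)
      then have "((\<lambda>x. cis (\<kappa> * x) / (\<i> * of_real \<kappa>)) has_vector_derivative cis (\<kappa> * x)) (at x within {0..L})"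
        using that by simp
      from has_vector_derivative_mult[OF has_vector_derivative_at_within[OF p'(2)] this]
      show ?thesis
        by (simp add: F_def[abs_def] R_def add.commute)
    qed
    then have "((\<lambda>x. R x + p x * cis (\<kappa> * x)) has_integral F L - F 0) {0..L}"
      using \<open>L \<ge> 0\<close> by (intro fundamental_theorem_of_calculus) auto
    moreover have "(R has_integral integral {0..L} R) {0..L}"
      using contR by (intro integrable_integral integrable_continuous_real)
    ultimately have "((\<lambda>x. R x + p x * cis (\<kappa> * x) - R x) has_integral F L - F 0 - integral {0..L} R) {0..L}"
      by (rule has_integral_diff)
    then have ip: "integral {0..L} (\<lambda>x. p x * cis (\<kappa> * x)) = F L - F 0 - integral {0..L} R"
      by (simp add: integral_unique)
    have nF: "norm (F x) \<le> B / \<kappa>" "norm (R x) \<le> B / \<kappa>" if "x \<in> {0..L}" for x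
      using B[OF that] \<open>\<kappa> > 0\<close> by (simp_all add: F_def R_def norm_mult norm_divide divide_right_mono)
    have "norm (integral {0..L} R) \<le> B / \<kappa> * (L - 0)"
      using \<open>L \<ge> 0\<close> nF contR by (intro integral_bound) auto
    then have "norm (integral {0..L} (\<lambda>x. p x * cis (\<kappa> * x))) \<le> B / \<kappa> + B / \<kappa> + B / \<kappa> * L"
      unfolding ip using norm_triangle_ineq4[of "F L - F 0" "integral {0..L} R"]
        norm_triangle_ineq4[of "F L" "F 0"] nF[of 0] nF[of L] \<open>L \<ge> 0\<close> by simp
    also have "\<dots> = C / \<kappa>"
      using that by (simp add: C_def field_simps)
    finally have 1: "norm (integral {0..L} (\<lambda>x. p x * cis (\<kappa> * x))) \<le> C / \<kappa>" .
    have "norm (integral {0..L} (\<lambda>x. (f x - p x) * cis (\<kappa> * x))) \<le> \<eta> * (L - 0)"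
      using \<open>L \<ge> 0\<close> p(2) by (intro integral_bound)
        (auto intro!: continuous_intros f cont cc simp: norm_mult less_imp_le)
    with \<eta>(2) have 2: "norm (integral {0..L} (\<lambda>x. (f x - p x) * cis (\<kappa> * x))) \<le> \<epsilon> / 2"
      by simp
    have "integral {0..L} (\<lambda>x. f x * cis (\<kappa> * x))
        = integral {0..L} (\<lambda>x. (f x - p x) * cis (\<kappa> * x) + p x * cis (\<kappa> * x))"
      by (simp add: algebra_simps)
    also have "\<dots> = integral {0..L} (\<lambda>x. (f x - p x) * cis (\<kappa> * x)) + integral {0..L} (\<lambda>x. p x * cis (\<kappa> * x))"
      by (intro Henstock_Kurzweil_Integration.integral_add integrable_continuous_real continuous_intros f cont cc)
    finally have "norm (integral {0..L} (\<lambda>x. f x * cis (\<kappa> * x))) \<le> \<epsilon> / 2 + C / \<kappa>"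
      by (rule ssubst) (rule norm_triangle_le, use 1 2 in linarith)
    moreover have "continuous_on {0..L} (\<lambda>x. f x * cis (\<kappa> * x))"
      by (intro continuous_intros f cc)
    ultimately show ?thesis
      by (simp add: set_lebesgue_integral_continuous)
  qed
  have "\<forall>\<^sub>F n in sequentially. k n > max 0 (2 * C / \<epsilon>)"
    using k by (simp only: filterlim_at_top_dense)
  then show "\<forall>\<^sub>F n in sequentially. dist (LINT x:{0..L}|lborel. f x * cis (k n * x)) 0 < \<epsilon>"
  proof eventually_elim
    case (elim n)
    then have lt: "C / k n < \<epsilon> / 2"
      using \<open>\<epsilon> > 0\<close> by (simp add: field_simps)
    have "norm (LINT x:{0..L}|lborel. f x * cis (k n * x)) \<le> \<epsilon> / 2 + C / k n"
      using elim by (intro bound) simp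
    also have "\<dots> < \<epsilon>"
      using lt by linarith
    finally show ?case
      by (simp add: dist_norm)
  qed
qed

lemma norm_bond_wave_square:
  "(cmod (bond_wave len k a e x))\<^sup>2 = edge_intensity e a
    + 2 * Re (a $ (e, True) * cnj (a $ (e, False)) * cis (- (k * len $ e)) * cis (2 * k * x))"
proof -
  have sq: "(cmod (y + z))\<^sup>2 = (cmod y)\<^sup>2 + (cmod z)\<^sup>2 + 2 * Re (y * cnj z)" for y z
    unfolding cmod_power2 by (simp add: power2_eq_square algebra_simps)
  have "a $ (e, True) * cis (k * (x - len $ e)) * cnj (a $ (e, False) * cis (- (k * x)))
      = a $ (e, True) * cnj (a $ (e, False)) * (cis (k * (x - len $ e)) * cis (k * x))"
    by (simp add: cis_cnj)
  also have "cis (k * (x - len $ e)) * cis (k * x) = cis (- (k * len $ e)) * cis (2 * k * x)"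
    by (simp add: cis_mult algebra_simps)
  finally have "a $ (e, True) * cis (k * (x - len $ e)) * cnj (a $ (e, False) * cis (- (k * x)))
      = a $ (e, True) * cnj (a $ (e, False)) * cis (- (k * len $ e)) * cis (2 * k * x)"
    by (simp only: mult.assoc)
  then show ?thesis
    unfolding bond_wave_def sq by (simp only: edge_intensity_def norm_mult norm_cis mult_1_right)
qed

lemma wave_density_limit:
  assumes \<phi>: "continuous_on {0..len $ e} \<phi>" and len: "len $ e \<ge> 0"
    and k: "filterlim k at_top sequentially" and a: "a \<longlonglongrightarrow> a\<^sub>0"
  shows "(\<lambda>n. LINT x:{0..len $ e}|lborel. \<phi> x * (cmod (bond_wave len (k n) (a n) e x))\<^sup>2)
    \<longlonglongrightarrow> edge_intensity e a\<^sub>0 * (LINT x:{0..len $ e}|lborel. \<phi> x)"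
proof -
  let ?I = "{0..len $ e}"
  define c where "c n = a n $ (e, True) * cnj (a n $ (e, False)) * cis (- (k n * len $ e))" for n
  define X where "X n = (LINT x:?I|lborel. complex_of_real (\<phi> x) * cis (2 * k n * x))" for n
  have ca: "(\<lambda>n. a n $ b) \<longlonglongrightarrow> a\<^sub>0 $ b" for b
    using a by (rule tendsto_vec_nth)
  have eq: "(LINT x:?I|lborel. \<phi> x * (cmod (bond_wave len (k n) (a n) e x))\<^sup>2)
      = edge_intensity e (a n) * (LINT x:?I|lborel. \<phi> x) + 2 * Re (c n * X n)" for n
  proof -
    have cont: "continuous_on ?I (\<lambda>x. complex_of_real (\<phi> x) * cis (2 * k n * x))"
      by (intro continuous_intros \<phi>)
    then have X: "((\<lambda>x. complex_of_real (\<phi> x) * cis (2 * k n * x)) has_integral X n) ?I"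
      unfolding X_def set_lebesgue_integral_continuous[OF cont]
      by (intro integrable_integral integrable_continuous_real)
    have "((\<lambda>x. Re (c n * (complex_of_real (\<phi> x) * cis (2 * k n * x)))) has_integral Re (c n * X n)) ?I"
      using has_integral_linear[OF has_integral_mult_right[OF X, of "c n"] bounded_linear_Re] by (simp add: o_def)
    moreover have "(\<phi> has_integral (LINT x:?I|lborel. \<phi> x)) ?I"
      unfolding set_lebesgue_integral_continuous[OF \<phi>]
      by (intro integrable_integral integrable_continuous_real \<phi>)
    ultimately have "((\<lambda>x. edge_intensity e (a n) * \<phi> x + 2 * Re (c n * (complex_of_real (\<phi> x) * cis (2 * k n * x))))
        has_integral edge_intensity e (a n) * (LINT x:?I|lborel. \<phi> x) + 2 * Re (c n * X n)) ?I"
      by (intro has_integral_add has_integral_mult_right)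
    moreover have "edge_intensity e (a n) * \<phi> x + 2 * Re (c n * (complex_of_real (\<phi> x) * cis (2 * k n * x)))
        = \<phi> x * (cmod (bond_wave len (k n) (a n) e x))\<^sup>2" for x
    proof -
      have "Re (c n * (complex_of_real (\<phi> x) * cis (2 * k n * x))) = \<phi> x * Re (c n * cis (2 * k n * x))"
        by (simp add: algebra_simps)
      then show ?thesis
        by (simp add: norm_bond_wave_square c_def algebra_simps)
    qed
    ultimately have "((\<lambda>x. \<phi> x * (cmod (bond_wave len (k n) (a n) e x))\<^sup>2)
        has_integral edge_intensity e (a n) * (LINT x:?I|lborel. \<phi> x) + 2 * Re (c n * X n)) ?I"
      by simp
    moreover have "continuous_on ?I (\<lambda>x. \<phi> x * (cmod (bond_wave len (k n) (a n) e x))\<^sup>2)"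
      by (intro continuous_intros \<phi> continuous_on_bond_wave)
    ultimately show ?thesis
      by (simp add: set_lebesgue_integral_continuous integral_unique)
  qed
  have lim1: "(\<lambda>n. edge_intensity e (a n) * (LINT x:?I|lborel. \<phi> x))
      \<longlonglongrightarrow> edge_intensity e a\<^sub>0 * (LINT x:?I|lborel. \<phi> x)"
    unfolding edge_intensity_def by (intro tendsto_intros ca)
  have lim2: "(\<lambda>n. 2 * Re (c n * X n)) \<longlonglongrightarrow> 0"
  proof -
    have "filterlim (\<lambda>n. 2 * k n) at_top sequentially"
      using k by (intro filterlim_tendsto_pos_mult_at_top[OF tendsto_const]) auto
    then have "X \<longlonglongrightarrow> 0"
      unfolding X_def by (intro Riemann_Lebesgue_cis continuous_intros \<phi> len)
    \<comment> \<open>Only the modulus of \<open>c n\<close> is used: convergence of the phase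
      \<open>cis (- (k n * len $ e))\<close> is not assumed.\<close>
    then have "(\<lambda>n. cmod (a n $ (e, True)) * cmod (a n $ (e, False)) * cmod (X n)) \<longlonglongrightarrow>
        cmod (a\<^sub>0 $ (e, True)) * cmod (a\<^sub>0 $ (e, False)) * cmod 0"
      by (intro tendsto_intros ca)
    then have "(\<lambda>n. c n * X n) \<longlonglongrightarrow> 0"
      by (subst tendsto_norm_zero_iff[symmetric]) (simp add: c_def norm_mult)
    then have "(\<lambda>n. 2 * Re (c n * X n)) \<longlonglongrightarrow> 2 * Re 0"
      by (intro tendsto_intros)
    then show ?thesis
      by simp
  qed
  show ?thesis
    unfolding eq using tendsto_add[OF lim1 lim2] by simp
qed


section \<open>Concentration on primitive subgraphs\<close>

text \<open>The amplitude vectors are normalised, the functions are not. The density limit with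
  constant test function 1 gives the limit of their squared norms, so division by the norms does not
  disturb convergence.\<close>

lemma normalized_waves:
  fixes G :: "('v, 'e::finite) qgraph"
  assumes len: "\<And>e. len $ e > 0" and k: "filterlim k at_top sequentially" and a: "a \<longlonglongrightarrow> a\<^sub>0"
    and fixed: "\<And>n. bond_fixed G (\<chi> e. cis (k n * len $ e)) (a n)"
    and N_pos: "(\<Sum>e\<in>UNIV. edge_intensity e a\<^sub>0 * len $ e) > 0"
  shows "\<exists>k' u. filterlim k' at_top sequentially \<and> (\<forall>n. L2_norm_on len UNIV (u n) = 1) \<and>
    (\<forall>n. neg_laplacian G len (u n) (\<lambda>e x. of_real ((k' n)\<^sup>2) * u n e x)) \<and>
    (\<forall>e \<phi>. continuous_on {0..len $ e} \<phi> \<longrightarrow>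
      (\<lambda>n. LINT x:{0..len $ e}|lborel. \<phi> x * (cmod (u n e x))\<^sup>2) \<longlonglongrightarrow>
        edge_intensity e a\<^sub>0 / (\<Sum>e\<in>UNIV. edge_intensity e a\<^sub>0 * len $ e) * (LINT x:{0..len $ e}|lborel. \<phi> x))"
proof -
  define N where "N = (\<Sum>e\<in>UNIV. edge_intensity e a\<^sub>0 * len $ e)"
  define M where "M n = (\<Sum>e\<in>UNIV. LINT x:{0..len $ e}|lborel. (cmod (bond_wave len (k n) (a n) e x))\<^sup>2)" for n
  have "M \<longlonglongrightarrow> N"
    unfolding M_def N_def
  proof (rule tendsto_sum)
    fix e
    show "(\<lambda>n. LINT x:{0..len $ e}|lborel. (cmod (bond_wave len (k n) (a n) e x))\<^sup>2)
        \<longlonglongrightarrow> edge_intensity e a\<^sub>0 * len $ e"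
      using wave_density_limit[of len e "\<lambda>_. 1", OF _ _ k a] len[of e]
      by (simp add: set_lebesgue_integral_continuous)
  qed
  moreover have "N > 0"
    using N_pos by (simp add: N_def)
  ultimately have "\<forall>\<^sub>F n in sequentially. M n > 0"
    by (rule order_tendstoD)
  \<comment> \<open>The squared norms are known to be positive only from \<open>n0\<close> on, so
    all sequences start there.\<close>
  then obtain n0 where n0: "\<And>n. n \<ge> n0 \<Longrightarrow> M n > 0"
    unfolding eventually_sequentially by blast
  define c where "c n = 1 / sqrt (M (n + n0))" for n
  define k' where "k' n = k (n + n0)" for n
  define a' where "a' n = complex_of_real (c n) *s a (n + n0)" for n
  define u where "u n = bond_wave len (k' n) (a' n)" for n
  have lim_c: "c \<longlonglongrightarrow> 1 / sqrt N"
    unfolding c_def using LIMSEQ_ignore_initial_segment[OF \<open>M \<longlonglongrightarrow> N\<close>] \<open>N > 0\<close>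
    by (intro tendsto_intros) auto
  have k': "filterlim k' at_top sequentially"
    unfolding k'_def using k by (rule filterlim_compose) (rule filterlim_add_const_nat_at_top)
  have a': "a' \<longlonglongrightarrow> complex_of_real (1 / sqrt N) *s a\<^sub>0"
    unfolding a'_def
  proof (rule vec_tendstoI)
    fix b
    have "(\<lambda>n. complex_of_real (c n) * a (n + n0) $ b) \<longlonglongrightarrow> complex_of_real (1 / sqrt N) * a\<^sub>0 $ b"
      by (intro tendsto_intros lim_c LIMSEQ_ignore_initial_segment[OF tendsto_vec_nth[OF a]])
    then show "(\<lambda>n. (complex_of_real (c n) *s a (n + n0)) $ b) \<longlonglongrightarrow> (complex_of_real (1 / sqrt N) *s a\<^sub>0) $ b"
      by simp
  qed
  have fixed': "bond_fixed G (\<chi> e. cis (k' n * len $ e)) (a' n)" for n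
    unfolding a'_def k'_def using fixed by (rule bond_fixed_scale)
  have intensity: "edge_intensity e (complex_of_real (1 / sqrt N) *s a\<^sub>0) = edge_intensity e a\<^sub>0 / N" for e
    using \<open>N > 0\<close> by (simp add: edge_intensity_def norm_mult norm_divide power_divide add_divide_distrib)
  have "L2_norm_on len UNIV (u n) = 1" for n
  proof -
    have u: "u n e x = complex_of_real (c n) * bond_wave len (k (n + n0)) (a (n + n0)) e x" for e x
      by (simp add: u_def k'_def a'_def bond_wave_def algebra_simps)
    have "(\<Sum>e\<in>UNIV. LINT x:{0..len $ e}|lborel. (cmod (u n e x))\<^sup>2) = (c n)\<^sup>2 * M (n + n0)"
      by (simp add: u norm_mult power_mult_distrib M_def sum_distrib_left)
    also have "\<dots> = 1"
      using n0[of "n + n0"] by (simp add: c_def power_divide)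
    finally show ?thesis
      by (simp add: L2_norm_on_def)
  qed
  moreover have "neg_laplacian G len (u n) (\<lambda>e x. of_real ((k' n)\<^sup>2) * u n e x)" for n
    unfolding u_def by (rule neg_laplacian_wave[OF fixed'])
  moreover have "(\<lambda>n. LINT x:{0..len $ e}|lborel. \<phi> x * (cmod (u n e x))\<^sup>2) \<longlonglongrightarrow>
        edge_intensity e a\<^sub>0 / N * (LINT x:{0..len $ e}|lborel. \<phi> x)"
    if "continuous_on {0..len $ e} \<phi>" for e \<phi>
    using wave_density_limit[OF that _ k' a'] len[of e] unfolding u_def intensity by simp
  ultimately show ?thesis
    using k' unfolding N_def by blast
qed

lemma RAC_I:
  fixes G :: "('v, 'e::finite) qgraph"
  assumes ri: "rationally_independent len" and w: "\<And>e. cmod (w $ e) = 1"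
    and m: "bond_fixed G w m" "m \<noteq> 0" and unique: "\<And>a. bond_fixed G w a \<Longrightarrow> \<exists>c. a = c *s m"
    and supp: "\<And>e. edge_intensity e m > 0 \<longleftrightarrow> e \<in> K"
  shows "RAC G K len"
proof -
  define \<theta> :: "angle ^ 'e" where "\<theta> = (\<chi> e. abs_angle (Arg (w $ e)))"
  have "cis (Arg (w $ e)) = w $ e" for e
    using w[of e] cis_Arg[of "w $ e"] by (cases "w $ e = 0") (auto simp: sgn_div_norm)
  then have "(\<chi> e. cis_angle (\<theta> $ e)) = w"
    by (simp add: \<theta>_def cis_angle.abs_eq vec_eq_iff)
  then have fix_iff: "bond_evolution G \<theta> *v a = a \<longleftrightarrow> bond_fixed G w a" for a
    by (simp add: bond_evolution_fixed_iff)
  have "{a. bond_evolution G \<theta> *v a = a} = vec.span {m}"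
    unfolding fix_iff vec.span_singleton using unique bond_fixed_scale[OF m(1)] by blast
  moreover have "vec.dim (vec.span {m}) = 1"
    using m(2) vec.dim_span_eq_card_independent[of "{m}"] by simp
  ultimately have "\<theta> \<in> regular_supported_set G K"
    using m supp fix_iff by (auto simp: regular_supported_set_def secular_set_iff)
  moreover have "\<theta> \<in> orbit_closure len"
    unfolding \<theta>_def using ri by (rule orbit_closure_full)
  ultimately show ?thesis
    unfolding RAC_def by blast
qed

theorem corollary5p9:
  fixes G :: "('v::finite, 'e::finite) qgraph"
    and len :: "real ^ 'e"
    and K :: "'e set"
  assumes "connected_graph G"
    and "\<forall>e. len $ e > 0"
    and "rationally_independent len"
    and "primitive_subgraph G K"
    and "K \<noteq> UNIV"
  shows "RAC G K len \<and>
    (\<exists>(k :: nat \<Rightarrow> real) (u :: nat \<Rightarrow> 'e \<Rightarrow> real \<Rightarrow> complex).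
       filterlim k at_top sequentially \<and>
       (\<forall>n. L2_norm_on len UNIV (u n) = 1) \<and>
       (\<forall>n. neg_laplacian G len (u n) (\<lambda>e x. of_real ((k n)\<^sup>2) * u n e x)) \<and>
       (\<lambda>n. L2_norm_on len (- K) (u n)) \<longlonglongrightarrow> 0 \<and>
       densities_converge_weakly G len (\<lambda>n e x. (cmod (u n e x))\<^sup>2)
         (\<lambda>e x. if e \<in> K then 1 / (\<Sum>e'\<in>K. len $ e') else 0))"
proof -
  have len: "len $ e > 0" for e
    using assms(2) by blast
  obtain bs where bs: "simple_walk G bs" "K = fst ` set bs"
    using primitive_subgraph_imp_walk[OF assms(4)] by blast
  define m where "m = walk_mode G bs"
  have norm_m: "cmod (m $ b) = of_bool (fst b \<in> K)" for b
    using bs norm_walk_mode[of bs G b] by (simp add: m_def simple_walk_def)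
  have "K \<noteq> {}"
    using bs by (simp add: simple_walk_def)
  then have "m \<noteq> 0"
    using norm_m by (metis (mono_tags, lifting) all_not_in_conv fst_conv norm_zero of_bool_eq(2) zero_index zero_neq_one)
  obtain w where w: "\<And>e. cmod (w $ e) = 1" and fixed: "bond_fixed G w m"
    and unique: "\<And>a. bond_fixed G w a \<Longrightarrow> \<exists>c. a = c *s m"
    using exists_generic_phase[OF assms(1) bs(1)] assms(5) bs(2) unfolding m_def by blast
  have intensity: "edge_intensity e (c *s m) = (if e \<in> K then 2 * (cmod c)\<^sup>2 else 0)" for e c
    by (simp add: edge_intensity_def norm_mult norm_m)
  have "RAC G K len"
    using intensity[of _ 1] by (intro RAC_I[OF assms(3) w fixed \<open>m \<noteq> 0\<close> unique]) auto
  \<comment> \<open>The index sets both the lower bound for the frequency and the accuracy.\<close>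
  have "\<exists>k a. k \<ge> real n \<and> norm a = 1 \<and> bond_fixed G (\<chi> e. cis (k * len $ e)) a \<and>
      (\<forall>e. cmod (cis (k * len $ e) - w $ e) < 1 / real (Suc n))" for n
    by (rule orbit_hits_secular_set[OF assms(3) len w fixed \<open>m \<noteq> 0\<close>]) simp
  then obtain k a where k: "\<And>n. k n \<ge> real n" and a: "\<And>n. norm (a n) = 1"
      "\<And>n. bond_fixed G (\<chi> e. cis (k n * len $ e)) (a n)"
    and kw: "\<And>n e. cmod (cis (k n * len $ e) - w $ e) < 1 / real (Suc n)"
    by metis
  have "filterlim k at_top sequentially"
    using filterlim_real_sequentially by (rule filterlim_at_top_mono) (simp add: k)
  have lim_w: "(\<lambda>n. cis (k n * len $ e)) \<longlonglongrightarrow> w $ e" for e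
  proof (rule LIM_zero_cancel, rule Lim_null_comparison[OF _ lim_inverse_n'[THEN LIMSEQ_Suc]])
    show "\<forall>\<^sub>F n in sequentially. cmod (cis (k n * len $ e) - w $ e) \<le> 1 / real (Suc n)"
      using kw[of _ e] by (intro always_eventually allI) (simp add: less_imp_le)
  qed
  have "bounded (range a)"
    using a(1) by (auto simp: bounded_iff intro: exI[of _ 1])
  then obtain a\<^sub>0 r where r: "strict_mono r" and lim_a: "(a \<circ> r) \<longlonglongrightarrow> a\<^sub>0"
    using bounded_imp_convergent_subsequence by blast
  have "filterlim (k \<circ> r) at_top sequentially"
    unfolding o_def using \<open>filterlim k at_top sequentially\<close> filterlim_subseq[OF r] by (rule filterlim_compose)
  have "bond_fixed G w a\<^sub>0"
    unfolding bond_fixed_def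
  proof
    fix b
    have comp: "(\<lambda>n. a (r n) $ b) \<longlonglongrightarrow> a\<^sub>0 $ b" for b
      using tendsto_vec_nth[OF lim_a] by (simp add: o_def)
    have "(\<lambda>n. cis (k (r n) * len $ fst b) * (bond_scattering G *v a (r n)) $ b)
        \<longlonglongrightarrow> w $ fst b * (bond_scattering G *v a\<^sub>0) $ b"
      unfolding matrix_vector_mult_def vec_lambda_beta
      using LIMSEQ_subseq_LIMSEQ[OF lim_w[of "fst b"] r] by (intro tendsto_intros comp) (simp add: o_def)
    moreover have "cis (k (r n) * len $ fst b) * (bond_scattering G *v a (r n)) $ b = a (r n) $ b" for n
      using a(2)[of "r n", unfolded bond_fixed_def, rule_format, of b] by simp
    ultimately show "a\<^sub>0 $ b = w $ fst b * (bond_scattering G *v a\<^sub>0) $ b"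
      using LIMSEQ_unique[OF comp[of b]] by simp
  qed
  \<comment> \<open>Simplicity at \<open>w\<close> identifies the limit; its norm 1 then excludes
    \<open>c = 0\<close>.\<close>
  then obtain c where c: "a\<^sub>0 = c *s m"
    using unique by blast
  have "norm a\<^sub>0 = 1"
    using LIMSEQ_unique[OF tendsto_norm[OF lim_a]] a(1) by (simp add: o_def)
  then have "c \<noteq> 0"
    using c by auto
  define L where "L = (\<Sum>e\<in>K. len $ e)"
  have "L > 0"
    unfolding L_def using \<open>K \<noteq> {}\<close> len by (intro sum_pos) auto
  have int0: "edge_intensity e a\<^sub>0 = (if e \<in> K then 2 * (cmod c)\<^sup>2 else 0)" for e
    by (simp add: c intensity)
  have total: "(\<Sum>e\<in>UNIV. edge_intensity e a\<^sub>0 * len $ e) = 2 * (cmod c)\<^sup>2 * L"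
  proof -
    have "(\<Sum>e\<in>UNIV. edge_intensity e a\<^sub>0 * len $ e) = (\<Sum>e\<in>K. 2 * (cmod c)\<^sup>2 * len $ e)"
      by (rule sum.mono_neutral_cong_right) (auto simp: int0)
    then show ?thesis
      by (simp add: L_def sum_distrib_left)
  qed
  \<comment> \<open>The unknown scalar cancels, since the mode has the same intensity on all edges
    of K.\<close>
  have ratio: "edge_intensity e a\<^sub>0 / (2 * (cmod c)\<^sup>2 * L) = (if e \<in> K then 1 / L else 0)" for e
    using \<open>c \<noteq> 0\<close> by (simp add: int0)
  have pos: "(\<Sum>e\<in>UNIV. edge_intensity e a\<^sub>0 * len $ e) > 0"
    using \<open>c \<noteq> 0\<close> \<open>L > 0\<close> by (simp add: total)
  have fixed_r: "bond_fixed G (\<chi> e. cis ((k \<circ> r) n * len $ e)) ((a \<circ> r) n)" for n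
    using a(2) by simp
  obtain k' u where u: "filterlim k' at_top sequentially" "\<forall>n. L2_norm_on len UNIV (u n) = 1"
      "\<forall>n. neg_laplacian G len (u n) (\<lambda>e x. of_real ((k' n)\<^sup>2) * u n e x)"
    and dens: "\<And>e \<phi>. continuous_on {0..len $ e} \<phi> \<Longrightarrow>
      (\<lambda>n. LINT x:{0..len $ e}|lborel. \<phi> x * (cmod (u n e x))\<^sup>2) \<longlonglongrightarrow>
        (if e \<in> K then 1 / L else 0) * (LINT x:{0..len $ e}|lborel. \<phi> x)"
    using normalized_waves[OF len \<open>filterlim (k \<circ> r) at_top sequentially\<close> lim_a fixed_r pos]
    unfolding total ratio by blast
  have "(\<lambda>n. L2_norm_on len (- K) (u n)) \<longlonglongrightarrow> 0"
  proof -
    have "(\<lambda>n. \<Sum>e\<in>- K. LINT x:{0..len $ e}|lborel. (cmod (u n e x))\<^sup>2) \<longlonglongrightarrow> (\<Sum>e\<in>- K. 0)"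
    proof (rule tendsto_sum)
      fix e assume "e \<in> - K"
      then show "(\<lambda>n. LINT x:{0..len $ e}|lborel. (cmod (u n e x))\<^sup>2) \<longlonglongrightarrow> 0"
        using dens[of e "\<lambda>_. 1"] by simp
    qed
    then have "(\<lambda>n. L2_norm_on len (- K) (u n)) \<longlonglongrightarrow> sqrt (\<Sum>e\<in>- K. 0)"
      unfolding L2_norm_on_def by (rule tendsto_real_sqrt)
    then show ?thesis
      by simp
  qed
  moreover have "densities_converge_weakly G len (\<lambda>n e x. (cmod (u n e x))\<^sup>2)
         (\<lambda>e x. if e \<in> K then 1 / (\<Sum>e'\<in>K. len $ e') else 0)"
    unfolding densities_converge_weakly_def L_def[symmetric]
  proof (intro allI impI tendsto_sum)
    fix \<phi> e assume "continuous_on_graph G len \<phi>"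
    then have "continuous_on {0..len $ e} (\<phi> e)"
      by (simp add: continuous_on_graph_def)
    from dens[OF this]
    show "(\<lambda>n. LINT x:{0..len $ e}|lborel. \<phi> e x * (cmod (u n e x))\<^sup>2)
        \<longlonglongrightarrow> (LINT x:{0..len $ e}|lborel. \<phi> e x * (if e \<in> K then 1 / L else 0))"
      by (simp add: mult.commute)
  qed
  ultimately show ?thesis
    using \<open>RAC G K len\<close> u by blast
qed

end
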